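(* Let $\Phi_1\in \mathscr U$ and $\Phi_2\in \tilde{\mathscr U}$. Assume that $\frac{\Phi_2}{\Phi_1}$ is non-decreasing. Let $\alpha>-1$ and define for $t\in (0,\infty)$ $$\omega(t)=\frac{\Phi_2^{-1}\left(\frac{1}{t^{2+\alpha}}\right)}{\Phi_1^{-1}\left(\frac{1}{t}\right)}.$$ Then: (i) If $\Phi_1$ satisfies the $\nabla_2$-condition and $\omega$ is equivalent to $1$, then $\mathcal{M}\left(H^{\Phi_1}(\mathbb{C}_+),A_\alpha^{\Phi_2}(\mathbb{C}_+)\right)=H^\infty(\mathbb{C}_+)$. (ii) If $\omega$ is non-decreasing on $(0,\infty)$ and $\lim_{t\rightarrow 0}\omega(t)=0$, then $\mathcal{M}\left(H^{\Phi_1}(\mathbb{C}_+),A_\alpha^{\Phi_2}(\mathbb{C}_+)\right)=\{0\}$. (iii) If $\Phi_1$ and $\Phi_2\circ\Phi_1^{-1}$ satisfy the $\nabla_2$-condition and $\omega$ is non-increasing on $(0,\infty)$, then $\mathcal{M}\left(H^{\Phi_1}(\mathbb{C}_+),A_\alpha^{\Phi_2}(\mathbb{C}_+)\right)=\mathcal H_\omega^\infty(\mathbb{C}_+)$.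
   Context: $\mathbb{C}_+=\{x+iy: y>0\}$. A growth function is a continuous nondecreasing function from $[0,\infty)$ onto $[0,\infty)$; $\Phi^{-1}$ is its inverse. $\mathscr{U}^q$ ($q\ge1$) is the set of growth functions $\Phi$ with $\Phi(st)\le Ct^q\Phi(s)$ for $s>0,t\ge1$ and $t\mapsto\Phi(t)/t$ nondecreasing; $\mathscr{U}=\bigcup_{q\ge1}\mathscr{U}^q$. $\tilde{\mathscr U}$ is the set of $\Phi\in\mathscr U^q$ (some $q\ge1$) such that there are constants $C_1,C_2,C_3>0$ with: $\Phi(st)\le C_1\Phi(s)\Phi(t)$ for all $s,t>0$; $\Phi(a/b)\le C_2\Phi(a)/b^q$ for all $a,b\ge1$; $\Phi(a/b)\le C_3\Phi(a)/\Phi(b)$ for all $0<a\le b\le1$. A convex growth function $\Phi$ satisfies the $\nabla_2$-condition if both $\Phi$ and its complementary function $\Psi(s)=\sup_{t\ge0}\{ts-\Phi(t)\}$ satisfy $F(2t)\le KF(t)$ for some $K>1$, all $t\ge0$. $H^\Phi(\mathbb{C}_+)$: holomorphic $f$ with $\|f\|_{H^\Phi}^{lux}:=\sup_{y>0}\inf\{\lambda>0:\int_{\mathbb{R}}\Phi(|f(x+iy)|/\lambda)dx\le1\}<\infty$. $dV_\alpha(x+iy)=y^\alpha dxdy$; $A^\Phi_\alpha(\mathbb{C}_+)$: holomorphic $f$ with $\int\Phi(|f|)dV_\alpha<\infty$, with $\|f\|^{lux}_{\Phi,\alpha}=\inf\{\lambda>0:\int\Phi(|f|/\lambda)dV_\alpha\le1\}$.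 For spaces $X,Y$ of analytic functions with these (quasi-)norms, $\mathcal M(X,Y)$ is the set of analytic $g$ on $\mathbb{C}_+$ for which there is $C>0$ with $\|fg\|_Y\le C\|f\|_X$ for all $f\in X$. $H^\infty(\mathbb{C}_+)$ is the space of bounded analytic functions on $\mathbb{C}_+$; $\mathcal H^\infty_\omega(\mathbb{C}_+)$ is the space of analytic $f$ with $\sup_{z\in\mathbb{C}_+}|f(z)|/\omega(\Im z)<\infty$. "$\omega$ equivalent to 1" means $c\le\omega(t)\le C$ for all $t>0$ for some constants $0<c\le C$. *)

theory Defs
  imports "HOL-Analysis.Analysis"
begin

definition UHP :: "complex set" where
  "UHP = {z. Im z > 0}"

definition growth_function :: "(real \<Rightarrow> real) \<Rightarrow> bool" where
  "growth_function \<Phi> \<longleftrightarrow> continuous_on {0..} \<Phi> \<and> mono_on {0..} \<Phi> \<and> \<Phi> ` {0..} = {0..}"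

definition ginv :: "(real \<Rightarrow> real) \<Rightarrow> real \<Rightarrow> real" where
  "ginv \<Phi> = the_inv_into {0..} \<Phi>"

definition classU_q :: "real \<Rightarrow> (real \<Rightarrow> real) set" where
  "classU_q q = {\<Phi>. growth_function \<Phi> \<and>
      (\<exists>C. \<forall>s>0. \<forall>t\<ge>1. \<Phi> (s * t) \<le> C * t powr q * \<Phi> s) \<and>
      mono_on {0<..} (\<lambda>t. \<Phi> t / t)}"

definition classU :: "(real \<Rightarrow> real) set" where
  "classU = (\<Union>q\<in>{1..}. classU_q q)"

definition classU_tilde :: "(real \<Rightarrow> real) set" where
  "classU_tilde = {\<Phi>. \<exists>q\<ge>1. \<Phi> \<in> classU_q q \<and>
      (\<exists>C1>0. \<forall>s>0. \<forall>t>0. \<Phi> (s * t) \<le> C1 * \<Phi> s * \<Phi> t) \<and>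
      (\<exists>C2>0. \<forall>a\<ge>1. \<forall>b\<ge>1. \<Phi> (a / b) \<le> C2 * \<Phi> a / b powr q) \<and>
      (\<exists>C3>0. \<forall>a b. 0 < a \<and> a \<le> b \<and> b \<le> 1 \<longrightarrow> \<Phi> (a / b) \<le> C3 * \<Phi> a / \<Phi> b)}"

text \<open>Complementary function (may take the value oo, hence ereal).\<close>
definition complementary :: "(real \<Rightarrow> real) \<Rightarrow> real \<Rightarrow> ereal" where
  "complementary \<Phi> s = (SUP t\<in>{0..}. ereal (t * s - \<Phi> t))"

definition nabla2 :: "(real \<Rightarrow> real) \<Rightarrow> bool" where
  "nabla2 \<Phi> \<longleftrightarrow> growth_function \<Phi> \<and> convex_on {0..} \<Phi> \<and>
     (\<exists>K>1. \<forall>t\<ge>0. \<Phi> (2 * t) \<le> K * \<Phi> t) \<and>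
     (\<exists>K>1. \<forall>t\<ge>0. complementary \<Phi> (2 * t) \<le> ereal K * complementary \<Phi> t)"

definition lux_H :: "(real \<Rightarrow> real) \<Rightarrow> (complex \<Rightarrow> complex) \<Rightarrow> ennreal" where
  "lux_H \<Phi> f = (SUP y\<in>{0<..}. INF r\<in>{r::real. r > 0 \<and>
      (\<integral>\<^sup>+ x. ennreal (\<Phi> (cmod (f (Complex x y)) / r)) \<partial>lborel) \<le> 1}. ennreal r)"

definition hardy_orlicz :: "(real \<Rightarrow> real) \<Rightarrow> (complex \<Rightarrow> complex) set" where
  "hardy_orlicz \<Phi> = {f. f holomorphic_on UHP \<and> lux_H \<Phi> f < \<infinity>}"

definition Vint :: "real \<Rightarrow> (complex \<Rightarrow> real) \<Rightarrow> ennreal" where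
  "Vint \<alpha> h = (\<integral>\<^sup>+ z. indicator UHP z * ennreal (Im z powr \<alpha> * h z) \<partial>lborel)"

definition lux_A :: "(real \<Rightarrow> real) \<Rightarrow> real \<Rightarrow> (complex \<Rightarrow> complex) \<Rightarrow> ennreal" where
  "lux_A \<Phi> \<alpha> f = (INF r\<in>{r::real. r > 0 \<and>
      Vint \<alpha> (\<lambda>z. \<Phi> (cmod (f z) / r)) \<le> 1}. ennreal r)"

definition bergman_orlicz :: "(real \<Rightarrow> real) \<Rightarrow> real \<Rightarrow> (complex \<Rightarrow> complex) set" where
  "bergman_orlicz \<Phi> \<alpha> = {f. f holomorphic_on UHP \<and> Vint \<alpha> (\<lambda>z. \<Phi> (cmod (f z))) < \<infinity>}"

definition multipliers_HA ::
  "(real \<Rightarrow> real) \<Rightarrow> (real \<Rightarrow> real) \<Rightarrow> real \<Rightarrow> (complex \<Rightarrow> complex) set" where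
  "multipliers_HA \<Phi>1 \<Phi>2 \<alpha> = {g. g holomorphic_on UHP \<and>
      (\<exists>C>0. \<forall>f\<in>hardy_orlicz \<Phi>1.
          lux_A \<Phi>2 \<alpha> (\<lambda>z. f z * g z) \<le> ennreal C * lux_H \<Phi>1 f)}"

definition H_infty :: "(complex \<Rightarrow> complex) set" where
  "H_infty = {f. f holomorphic_on UHP \<and> bounded (f ` UHP)}"

definition H_infty_weighted :: "(real \<Rightarrow> real) \<Rightarrow> (complex \<Rightarrow> complex) set" where
  "H_infty_weighted \<omega> = {f. f holomorphic_on UHP \<and>
      (\<exists>C. \<forall>z\<in>UHP. cmod (f z) / \<omega> (Im z) \<le> C)}"

definition omega_weight :: "(real \<Rightarrow> real) \<Rightarrow> (real \<Rightarrow> real) \<Rightarrow> real \<Rightarrow> real \<Rightarrow> real" where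
  "omega_weight \<Phi>1 \<Phi>2 \<alpha> t = ginv \<Phi>2 (1 / t powr (2 + \<alpha>)) / ginv \<Phi>1 (1 / t)"

end

theory Submission
  imports Defs "HOL-Complex_Analysis.Complex_Analysis"
begin

text \<open>
  Necessity. The function f(w) = b (2iy / (w - cnj z))^2, with y = Im z and b the value of the inverse
  of Phi1 at 1/y, has norm at most a constant in the Hardy-Orlicz space, and point evaluation at z on
  the Bergman-Orlicz space costs the inverse of Phi2 at y^(-2-alpha); hence every multiplier satisfies
  |g(z)| \<le> C omega(y). If omega vanishes at 0, then g extended by 0 is entire and hence zero.

  Sufficiency. Put kappa(y) = 1 / (y^2 Phi3(1/y)), where Phi3 is Phi2 composed with the inverse of Phi1.
  If |g| \<le> C omega, then y^alpha Phi2(|g| t) is at most a constant times kappa(y) Phi2(t), so the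
  measure kappa(Im z) dA has to be a Carleson measure. By the Poisson formula f is dominated on vertical
  lines by a Hardy-Littlewood maximal function, which is bounded on the Orlicz class because the
  nabla2-condition forces Phi1(s)/s to grow at least like a power; integrating kappa(y) Phi2(|f|) along
  a vertical line then yields at most a constant times Phi1 of the maximal function.
\<close>

section \<open>Functions of class U and their inverses\<close>

text \<open>A function of class U need not be convex; only \<Phi>(t)/t is nondecreasing. So Jensen's
  inequality and the subharmonicity of \<Phi>(|f|) are not at hand, and every Orlicz estimate is
  reduced to one for the integral of |f| itself, through t \<le> s + (s/\<Phi>(s)) \<Phi>(t) with a
  level s fitted to the scale at hand. Boundary values are bypassed: the maximal function is built
  above a line Im w = e, where f is bounded and continuous, all constants are independent of e, and
  Fatou's lemma lets e tend to 0. Growth faster than linear is used twice. For \<Phi>1 it makes the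
  maximal operator bounded; for Phi3 it makes the integral along a vertical line converge near the
  boundary. In (iii) both come from the nabla2-condition. In (i) the growth of Phi3 comes from
  omega: a weight equivalent to 1 makes Phi3(s) comparable with s^(2+\<alpha>), hence kappa(y) with
  y^\<alpha>.\<close>

locale U_function =
  fixes \<Phi> :: "real \<Rightarrow> real"
  assumes classU: "\<Phi> \<in> classU"
begin

lemma growth: "growth_function \<Phi>"
  and ratio_mono_on: "mono_on {0<..} (\<lambda>t. \<Phi> t / t)"
  using classU by (auto simp: classU_def classU_q_def)

lemma ratio_mono: "0 < s \<Longrightarrow> s \<le> t \<Longrightarrow> \<Phi> s / s \<le> \<Phi> t / t"
  using ratio_mono_on by (auto simp: mono_on_def)

lemma continuous: "continuous_on {0..} \<Phi>"
  and mono: "0 \<le> s \<Longrightarrow> s \<le> t \<Longrightarrow> \<Phi> s \<le> \<Phi> t"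
  and image: "\<Phi> ` {0..} = {0..}"
  using growth by (auto simp: growth_function_def mono_on_def)

lemma nonneg: "0 \<le> t \<Longrightarrow> 0 \<le> \<Phi> t"
  using image by auto

lemma zero [simp]: "\<Phi> 0 = 0"
proof -
  obtain t where "t \<ge> 0" "\<Phi> t = 0"
    using image by (metis atLeast_iff imageE order_refl)
  thus ?thesis using mono[of 0 t] nonneg[of 0] by simp
qed

lemma upper_type:
  obtains C q where "C > 0" "q \<ge> 1" "\<And>s t. 0 < s \<Longrightarrow> 1 \<le> t \<Longrightarrow> \<Phi> (s * t) \<le> C * t powr q * \<Phi> s"
proof -
  obtain q C where q: "q \<ge> 1" and C: "\<And>s t. 0 < s \<Longrightarrow> 1 \<le> t \<Longrightarrow> \<Phi> (s * t) \<le> C * t powr q * \<Phi> s"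
    using classU by (auto simp: classU_def classU_q_def)
  have "\<Phi> (s * t) \<le> max C 1 * t powr q * \<Phi> s" if "0 < s" "1 \<le> t" for s t
  proof -
    have "C * (t powr q * \<Phi> s) \<le> max C 1 * (t powr q * \<Phi> s)"
      using nonneg[of s] that by (intro mult_right_mono) auto
    thus ?thesis using C[OF that] by (simp add: mult.assoc)
  qed
  thus ?thesis using that[of "max C 1" q] q by simp
qed

text \<open>By \<open>upper_type\<close> a zero at some t > 0 would spread to every larger argument,
  and \<Phi> would never reach the value 1.\<close>

lemma pos: assumes "0 < t" shows "0 < \<Phi> t"
proof (rule ccontr)
  assume "\<not> 0 < \<Phi> t"
  hence 0: "\<Phi> t = 0" using nonneg[of t] assms by simp
  obtain C q where C: "\<And>s t. 0 < s \<Longrightarrow> 1 \<le> t \<Longrightarrow> \<Phi> (s * t) \<le> C * t powr q * \<Phi> s"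
    by (rule upper_type) blast
  obtain u where u: "u \<ge> 0" "\<Phi> u = 1"
    using image by (metis atLeast_iff imageE zero_le_one)
  have "\<Phi> u \<le> \<Phi> (t * max 1 (u / t))"
    using u assms by (intro mono) (auto simp: max_def field_simps)
  also have "\<dots> \<le> 0" using C[of t "max 1 (u/t)"] assms 0 by simp
  finally show False using u by simp
qed

text \<open>The substitute for convexity, obtained from the monotone ratio. It lets a constant in
  front of a modular be absorbed inside \<Phi>, and so turns modular bounds into bounds for
  Luxemburg norms.\<close>

lemma scale_le:
  assumes "0 \<le> c" "c \<le> 1" "0 \<le> t" shows "\<Phi> (c * t) \<le> c * \<Phi> t"
proof (cases "c * t = 0")
  case False
  hence p: "c > 0" "t > 0" using assms by auto
  have "\<Phi> (c * t) / (c * t) \<le> \<Phi> t / t"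
    using p assms by (intro ratio_mono) (auto simp: mult_le_cancel_right1)
  thus ?thesis using p by (simp add: field_simps)
qed (use assms nonneg[of t] in auto)

text \<open>A growth function is only nondecreasing; strictness comes from \<open>pos\<close> and
  the monotone ratio. It makes \<Phi> injective on the half-line, so that \<open>ginv \<Phi>\<close>
  is a genuine inverse there.\<close>

lemma strict_mono: assumes "0 \<le> s" "s < t" shows "\<Phi> s < \<Phi> t"
proof -
  have "\<Phi> ((s / t) * t) \<le> s / t * \<Phi> t" using assms by (intro scale_le) auto
  also have "\<dots> < 1 * \<Phi> t" using assms pos[of t] by (intro mult_strict_right_mono) auto
  finally show ?thesis using assms by simp
qed

lemma le_iff: "0 \<le> s \<Longrightarrow> 0 \<le> t \<Longrightarrow> \<Phi> s \<le> \<Phi> t \<longleftrightarrow> s \<le> t"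
  using strict_mono mono by (meson not_le)

lemma inj: "inj_on \<Phi> {0..}"
  by (rule inj_onI) (metis atLeast_iff le_iff order_antisym order_refl)

lemma ginv_nonneg: "0 \<le> s \<Longrightarrow> 0 \<le> ginv \<Phi> s"
  and f_ginv [simp]: "0 \<le> s \<Longrightarrow> \<Phi> (ginv \<Phi> s) = s"
  using the_inv_into_into[OF inj, of s "{0..}"] f_the_inv_into_f[OF inj, of s] image
  by (auto simp: ginv_def)

lemma ginv_f [simp]: "0 \<le> t \<Longrightarrow> ginv \<Phi> (\<Phi> t) = t"
  unfolding ginv_def by (rule the_inv_into_f_f[OF inj]) simp

lemma ginv_pos: "0 < s \<Longrightarrow> 0 < ginv \<Phi> s"
  using ginv_nonneg[of s] f_ginv[of s] zero by (metis less_eq_real_def less_irrefl)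

lemma ginv_le_iff: "0 \<le> s \<Longrightarrow> 0 \<le> t \<Longrightarrow> ginv \<Phi> s \<le> t \<longleftrightarrow> s \<le> \<Phi> t"
  using le_iff[of "ginv \<Phi> s" t] by (simp add: ginv_nonneg)

text \<open>The numerical factors that the geometry produces (2, 12, 32, a bound of |g|) are pulled
  out of \<Phi> by this lemma.\<close>

lemma doubling:
  assumes "K \<ge> 1"
  obtains B where "B \<ge> 1" "\<And>t. 0 \<le> t \<Longrightarrow> \<Phi> (K * t) \<le> B * \<Phi> t"
proof -
  obtain C q where C: "C > 0" "\<And>s t. 0 < s \<Longrightarrow> 1 \<le> t \<Longrightarrow> \<Phi> (s * t) \<le> C * t powr q * \<Phi> s"
    by (rule upper_type) blast
  have "\<Phi> (K * t) \<le> max 1 (C * K powr q) * \<Phi> t" if "0 \<le> t" for t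
  proof (cases "t = 0")
    case False
    have "\<Phi> (K * t) \<le> C * K powr q * \<Phi> t"
      using C(2)[of t K] that False assms by (simp add: mult.commute)
    also have "\<dots> \<le> max 1 (C * K powr q) * \<Phi> t"
      using nonneg[of t] that by (intro mult_right_mono) auto
    finally show ?thesis .
  qed auto
  thus ?thesis using that[of "max 1 (C * K powr q)"] by simp
qed

text \<open>Below the level s the first summand suffices; above it the ratio at t dominates the
  ratio at s. The inequality does the work of Jensen's: it bounds an integral of |f| by the measure
  of the set and the integral of \<Phi>(|f|), and s is chosen later to balance the two.\<close>

lemma affine_minorant:
  assumes "0 < s" "0 \<le> t" shows "t \<le> s + s / \<Phi> s * \<Phi> t"
proof (cases "t \<le> s")
  case True
  thus ?thesis using assms pos[of s] nonneg[of t] by (simp add: add_increasing2)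
next
  case False
  hence "\<Phi> s / s \<le> \<Phi> t / t" using assms by (intro ratio_mono) auto
  hence "t \<le> s / \<Phi> s * \<Phi> t" using False assms pos[of s] by (simp add: field_simps)
  thus ?thesis using assms by simp
qed

lemma borel_measurable_comp:
  assumes "f \<in> borel_measurable M" "\<And>x. 0 \<le> f x"
  shows "(\<lambda>x. \<Phi> (f x)) \<in> borel_measurable M"
proof -
  have "continuous_on UNIV (\<lambda>t. \<Phi> (max 0 t))"
    by (rule continuous_on_compose2[OF continuous]) (auto intro!: continuous_intros)
  from borel_measurable_continuous_on[OF this assms(1)] show ?thesis
    using assms(2) by simp
qed

lemma continuous_on_comp:
  assumes "continuous_on A f" "\<And>x. x \<in> A \<Longrightarrow> 0 \<le> f x"
  shows "continuous_on A (\<lambda>x. \<Phi> (f x))"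
  by (rule continuous_on_compose2[OF continuous assms(1)]) (use assms(2) in auto)

text \<open>A layer-cake inequality without differentiating \<Phi>: the density
  \<open>\<Phi> s / s\<close> stands in for the derivative. On (t/2, t) it is at least its value at
  t/2, and this interval has length t/2. The halved argument is the price, repaid by
  \<open>doubling\<close>.\<close>

lemma Phi_half_le:
  assumes "0 \<le> t"
  shows "ennreal (\<Phi> (t / 2)) \<le> (\<integral>\<^sup>+ s. ennreal (\<Phi> s / s) * indicator {0<..<t} s \<partial>lborel)"
proof (cases "t = 0")
  case False
  hence t: "t > 0" using assms by simp
  have "ennreal (\<Phi> (t / 2)) = ennreal (\<Phi> (t / 2) / (t / 2)) * ennreal (t - t / 2)"
    using t nonneg[of "t/2"] by (simp add: ennreal_mult[symmetric])
  also have "\<dots> = (\<integral>\<^sup>+ s. ennreal (\<Phi> (t / 2) / (t / 2)) * indicator {t/2<..<t} s \<partial>lborel)"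
    using t by (subst nn_integral_cmult_indicator) auto
  also have "\<dots> \<le> (\<integral>\<^sup>+ s. ennreal (\<Phi> s / s) * indicator {0<..<t} s \<partial>lborel)"
  proof (rule nn_integral_mono)
    fix s show "ennreal (\<Phi> (t / 2) / (t / 2)) * indicator {t/2<..<t} s \<le> ennreal (\<Phi> s / s) * indicator {0<..<t} s"
      using t ratio_mono[of "t/2" s] by (auto simp: indicator_def intro!: ennreal_leI)
  qed
  finally show ?thesis .
qed auto

end

text \<open>Young duality: if s is the slope of a supporting line at x, the complementary function
  at s is at most x s - \<Phi>(x). Its doubling condition, tested at the point K x / 2, gives K
  \<Phi>(x) \<le> \<Phi>(K x / 2). The outcome says that \<Phi>(x)/x at least doubles when x is
  multiplied by a fixed number above 1.\<close>

lemma nabla2_lower_type: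
  assumes "nabla2 \<Phi>"
  obtains K where "K > 1" "\<And>x. 0 < x \<Longrightarrow> 2 * K * \<Phi> x \<le> \<Phi> (K * x)"
proof -
  have gr: "growth_function \<Phi>" and cvx: "convex_on {0..} \<Phi>"
    using assms by (auto simp: nabla2_def)
  obtain K where K: "K > 1" "\<And>t. t \<ge> 0 \<Longrightarrow> complementary \<Phi> (2 * t) \<le> ereal K * complementary \<Phi> t"
    using assms by (auto simp: nabla2_def)
  have mono: "\<Phi> s \<le> \<Phi> t" if "0 \<le> s" "s \<le> t" for s t
    using gr that by (auto simp: growth_function_def mono_on_def)
  have nonneg: "0 \<le> \<Phi> t" if "0 \<le> t" for t
    using gr that by (auto simp: growth_function_def)
  have key: "K * \<Phi> x \<le> \<Phi> (K / 2 * x)" if x: "x > 0" for x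
  proof -
    \<comment> \<open>The right derivative at x, as infimum of the secant slopes to the right;
      convexity makes it the slope of a supporting line on the whole half-line.\<close>
    define s where "s = Inf ((\<lambda>t. (\<Phi> x - \<Phi> t) / (x - t)) ` ({x<..} \<inter> {0..}))"
    have sub: "\<Phi> y \<ge> \<Phi> x + s * (y - x)" if "y \<ge> 0" for y
      unfolding s_def by (rule convex_le_Inf_differential[OF cvx]) (use x that in auto)
    have s0: "s \<ge> 0"
      unfolding s_def
    proof (rule cInf_greatest)
      show "(\<lambda>t. (\<Phi> x - \<Phi> t) / (x - t)) ` ({x<..} \<inter> {0..}) \<noteq> {}"
        using x by (auto simp: ex_in_conv[symmetric] intro!: exI[of _ "x+1"])
      fix v assume "v \<in> (\<lambda>t. (\<Phi> x - \<Phi> t) / (x - t)) ` ({x<..} \<inter> {0..})"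
      thus "0 \<le> v" using x mono[of x] by (auto intro!: divide_nonpos_nonpos)
    qed
    have "complementary \<Phi> s \<le> ereal (x * s - \<Phi> x)"
      unfolding complementary_def
    proof (rule SUP_least)
      fix t :: real assume "t \<in> {0..}"
      thus "ereal (t * s - \<Phi> t) \<le> ereal (x * s - \<Phi> x)"
        using sub[of t] by (simp add: algebra_simps)
    qed
    hence "ereal K * complementary \<Phi> s \<le> ereal (K * (x * s - \<Phi> x))"
      using K(1) by (metis ereal_mult_left_mono less_eq_real_def order.trans times_ereal.simps(1) zero_le_one ereal_less_eq(5))
    \<comment> \<open>With the test point K/2 * x the linear terms on both sides are K x s and
      cancel.\<close>
    moreover have "ereal (K / 2 * x * (2 * s) - \<Phi> (K / 2 * x)) \<le> complementary \<Phi> (2 * s)"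
      unfolding complementary_def by (rule SUP_upper2[of "K / 2 * x"]) (use x K in auto)
    ultimately have "ereal (K / 2 * x * (2 * s) - \<Phi> (K / 2 * x)) \<le> ereal (K * (x * s - \<Phi> x))"
      using K(2)[OF s0] by (meson order.trans)
    thus ?thesis by (simp add: algebra_simps)
  qed
  \<comment> \<open>The constant returned is K/2 and must exceed 1. If K \<le> 2, a point u with
    \<open>\<Phi> u = 1\<close> would give K \<le> \<Phi>(K u / 2) \<le> 1.\<close>
  have "K > 2"
  proof (rule ccontr)
    assume "\<not> K > 2"
    obtain u where u: "u \<ge> 0" "\<Phi> u = 1"
      using gr unfolding growth_function_def by (metis atLeast_iff imageE zero_le_one)
    obtain u0 where u0: "u0 \<ge> 0" "\<Phi> u0 = 0"
      using gr unfolding growth_function_def by (metis atLeast_iff imageE order_refl)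
    have "u > 0" using u u0 mono[of 0 u0] nonneg[of 0] by (cases "u = 0") auto
    hence "K \<le> \<Phi> (K / 2 * u)" using key[of u] u by simp
    also have "\<dots> \<le> \<Phi> u" using \<open>\<not> K > 2\<close> \<open>u > 0\<close> K by (intro mono) auto
    finally show False using K u by simp
  qed
  thus ?thesis using that[of "K / 2"] key by (simp add: mult.commute)
qed

section \<open>Integral estimates for holomorphic functions\<close>

lemma borel_measurable_Complex [measurable]:
  "(\<lambda>(x, y). Complex x y) \<in> borel_measurable (borel \<Otimes>\<^sub>M borel)"
  unfolding borel_prod by (intro borel_measurable_continuous_onI)
    (auto simp: case_prod_beta Complex_eq intro!: continuous_intros)

lemma borel_measurable_continuous_on_ennreal:
  fixes g :: "complex \<Rightarrow> real"
  assumes "continuous_on A g" "A \<in> sets borel"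
  shows "(\<lambda>w. ennreal (g w) * indicator A w) \<in> borel_measurable borel"
proof -
  have "(\<lambda>w. indicator A w *\<^sub>R g w) \<in> borel_measurable borel"
    using assms by (intro borel_measurable_continuous_on_indicator)
  hence "(\<lambda>w. ennreal (indicator A w *\<^sub>R g w)) \<in> borel_measurable borel" by simp
  also have "(\<lambda>w. ennreal (indicator A w *\<^sub>R g w)) = (\<lambda>w. ennreal (g w) * indicator A w)"
    by (auto simp: indicator_def)
  finally show ?thesis .
qed

text \<open>Lebesgue measure on the complex numbers and the image of the product measure agree on
  boxes. The imaginary part is the outer variable, which suits norms defined by suprema over
  horizontal lines.\<close>

lemma nn_integral_complex:
  assumes [measurable]: "f \<in> borel_measurable borel"
  shows "(\<integral>\<^sup>+ z. f z \<partial>lborel) = (\<integral>\<^sup>+ y. \<integral>\<^sup>+ x. f (Complex x y) \<partial>lborel \<partial>lborel)"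
proof -
  have "lborel = distr (lborel \<Otimes>\<^sub>M lborel) borel (\<lambda>(x, y). Complex x y)"
  proof (rule lborel_eqI)
    fix l u :: complex assume le: "\<And>b. b \<in> Basis \<Longrightarrow> l \<bullet> b \<le> u \<bullet> b"
    have "Re l \<le> Re u" "Im l \<le> Im u" using le[of 1] le[of \<i>] by (auto simp: Basis_complex_def)
    moreover have "(\<lambda>(x, y). Complex x y) -` box l u \<inter> space (lborel \<Otimes>\<^sub>M lborel)
        = {Re l<..<Re u} \<times> {Im l<..<Im u}"
      by (auto simp: in_box_complex_iff space_pair_measure)
    ultimately show "emeasure (distr (lborel \<Otimes>\<^sub>M lborel) borel (\<lambda>(x, y). Complex x y)) (box l u)
        = (\<Prod>b\<in>Basis. (u - l) \<bullet> b)"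
      by (subst emeasure_distr)
         (auto simp: lborel.emeasure_pair_measure_Times Basis_complex_def ennreal_mult)
  qed simp
  hence "(\<integral>\<^sup>+ z. f z \<partial>lborel) = (\<integral>\<^sup>+ z. f z \<partial>distr (lborel \<Otimes>\<^sub>M lborel) borel (\<lambda>(x, y). Complex x y))"
    by simp
  also have "\<dots> = (\<integral>\<^sup>+ p. f (case p of (x, y) \<Rightarrow> Complex x y) \<partial>(lborel \<Otimes>\<^sub>M lborel))"
    by (subst nn_integral_distr) auto
  also have "\<dots> = (\<integral>\<^sup>+ y. \<integral>\<^sup>+ x. f (Complex x y) \<partial>lborel \<partial>lborel)"
    by (subst lborel_pair.nn_integral_snd[symmetric]) auto
  finally show ?thesis .
qed

text \<open>A unit direction e makes t the arc length; for e = 1 or e = \<i> it is the coordinate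
  along a horizontal or vertical side. The bound is an \<open>ennreal\<close> integral so that it
  can later be integrated in a further parameter without integrability checks.\<close>

lemma norm_contour_integral_linepath_le:
  fixes z e :: complex
  assumes "a < b" "norm e = 1"
    and cont: "continuous_on (closed_segment (z + of_real a * e) (z + of_real b * e)) G"
  shows "ennreal (norm (contour_integral (linepath (z + of_real a * e) (z + of_real b * e)) G))
    \<le> (\<integral>\<^sup>+ t. ennreal (norm (G (z + of_real t * e))) * indicator {a..b} t \<partial>lborel)"
proof -
  define p q where "p = z + of_real a * e" and "q = z + of_real b * e"
  define g where "g = (\<lambda>t. G (z + of_real t * e))"
  have lp: "linepath p q t = z + of_real (a + (b - a) * t) * e" for t
    by (simp add: linepath_def p_def q_def scaleR_conv_of_real algebra_simps)
  have qp: "norm (q - p) = b - a"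
  proof -
    have "q - p = of_real (b - a) * e" by (simp add: p_def q_def algebra_simps)
    thus ?thesis using assms(1,2) by (simp add: norm_mult del: of_real_diff)
  qed
  have contg: "continuous_on {a..b} g"
    unfolding g_def
  proof (rule continuous_on_compose2[OF cont])
    show "(\<lambda>t. z + of_real t * e) ` {a..b} \<subseteq> closed_segment (z + of_real a * e) (z + of_real b * e)"
    proof clarify
      fix t assume t: "t \<in> {a..b}"
      have "linepath p q ((t - a) / (b - a)) \<in> closed_segment p q"
        using t assms(1) by (intro linepath_in_path) (auto simp: field_simps)
      thus "z + of_real t * e \<in> closed_segment (z + of_real a * e) (z + of_real b * e)"
        using assms(1) unfolding lp by (simp add: p_def q_def)
    qed
  qed (intro continuous_intros)
  have cont01: "continuous_on {0..1} (\<lambda>t. g (a + (b - a) * t))"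
  proof (rule continuous_on_compose2[OF contg])
    have "a + (b - a) * t \<le> b" if "t \<le> 1" for t
      using mult_left_mono[of t 1 "b - a"] that assms(1) by (simp add: algebra_simps)
    thus "(\<lambda>t. a + (b - a) * t) ` {0..1} \<subseteq> {a..b}"
      using assms(1) by (auto simp: image_subset_iff)
  qed (intro continuous_intros)
  have int: "set_integrable lborel {0..1} (\<lambda>t. g (a + (b - a) * t))"
    by (intro borel_integrable_atLeastAtMost') (rule cont01)
  have "contour_integral (linepath p q) G = (q - p) * integral {0..1} (\<lambda>t. G (linepath p q t))"
    by (simp add: contour_integral_integral)
  hence "norm (contour_integral (linepath p q) G) = (b - a) * norm (integral {0..1} (\<lambda>t. g (a + (b - a) * t)))"
    by (simp only: norm_mult qp lp g_def)
  also have "integral {0..1} (\<lambda>t. g (a + (b - a) * t)) = (LINT t:{0..1}|lborel. g (a + (b - a) * t))"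
    using set_borel_integral_eq_integral[OF int] by simp
  also have "ennreal ((b - a) * norm (LINT t:{0..1}|lborel. g (a + (b - a) * t))) \<le>
     ennreal (b - a) * (\<integral>\<^sup>+ t. norm (indicator {0..1} t *\<^sub>R g (a + (b - a) * t)) \<partial>lborel)"
    using int assms(1) unfolding set_integrable_def set_lebesgue_integral_def
    by (subst ennreal_mult) (auto intro!: mult_left_mono integral_norm_bound_ennreal simp del: norm_scaleR)
  also have "(\<integral>\<^sup>+ t. norm (indicator {0..1} t *\<^sub>R g (a + (b - a) * t)) \<partial>lborel)
     = (\<integral>\<^sup>+ t. norm (indicator {a..b} (a + (b - a) * t) *\<^sub>R g (a + (b - a) * t)) \<partial>lborel)"
  proof (rule nn_integral_cong)
    fix t :: real
    have "a + (b - a) * t \<le> b \<longleftrightarrow> (b - a) * t \<le> (b - a) * 1" by (auto simp: algebra_simps)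
    also have "\<dots> \<longleftrightarrow> t \<le> 1" using assms(1) by (subst mult_le_cancel_left_pos) auto
    finally have "a + (b - a) * t \<in> {a..b} \<longleftrightarrow> t \<in> {0..1}"
      using assms(1) by (auto simp: zero_le_mult_iff)
    thus "ennreal (norm (indicator {0..1} t *\<^sub>R g (a + (b - a) * t)))
        = ennreal (norm (indicator {a..b} (a + (b - a) * t) *\<^sub>R g (a + (b - a) * t)))"
      by (simp add: indicator_def del: atLeastAtMost_iff)
  qed
  also have "ennreal (b - a) * \<dots> = (\<integral>\<^sup>+ t. norm (indicator {a..b} t *\<^sub>R g t) \<partial>lborel)"
  proof -
    have "(\<lambda>t. indicator {a..b} t *\<^sub>R g t) \<in> borel_measurable borel"
      using contg by (intro borel_measurable_continuous_on_indicator) auto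
    thus ?thesis
      using assms(1) by (subst (2) nn_integral_real_affine[where c = "b - a" and t = a]) (auto simp del: norm_scaleR)
  qed
  also have "\<dots> = (\<integral>\<^sup>+ t. ennreal (norm (g t)) * indicator {a..b} t \<partial>lborel)"
    by (intro nn_integral_cong) (auto simp: indicator_def)
  finally show ?thesis unfolding p_def q_def g_def .
qed

text \<open>Cauchy's formula with the norm taken inside each side integral. The domain S stays
  general because one application uses \<open>UHP\<close> and another a smaller half-plane that
  avoids an extra pole.\<close>

lemma Cauchy_rectangle_bound:
  assumes "open S" "convex S" "F holomorphic_on S"
    and sub: "cbox (Complex a c) (Complex b d) \<subseteq> S" and z: "z \<in> box (Complex a c) (Complex b d)"
  shows "ennreal (2 * pi * norm (F z)) \<le>
      (\<integral>\<^sup>+ t. ennreal (norm (F (Complex t c) / (Complex t c - z))) * indicator {a..b} t \<partial>lborel)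
    + (\<integral>\<^sup>+ t. ennreal (norm (F (Complex t d) / (Complex t d - z))) * indicator {a..b} t \<partial>lborel)
    + (\<integral>\<^sup>+ t. ennreal (norm (F (Complex a t) / (Complex a t - z))) * indicator {c..d} t \<partial>lborel)
    + (\<integral>\<^sup>+ t. ennreal (norm (F (Complex b t) / (Complex b t - z))) * indicator {c..d} t \<partial>lborel)"
proof -
  have less: "a < Re z" "Re z < b" "c < Im z" "Im z < d"
    using z by (auto simp: in_box_complex_iff)
  define G where "G = (\<lambda>w. F w / (w - z))"
  define R where "R = rectpath (Complex a c) (Complex b d)"
  have imR: "path_image R = cbox (Complex a c) (Complex b d) - box (Complex a c) (Complex b d)"
    unfolding R_def using less by (intro path_image_rectpath_cbox_minus_box) auto
  have R: "path_image R \<subseteq> S - {z}" using imR sub z by auto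
  have "(G has_contour_integral (2 * pi * \<i> * winding_number R z * F z)) R"
    unfolding G_def
    by (rule Cauchy_integral_formula_convex_simple)
       (use assms R less in \<open>auto simp: R_def interior_open subset_iff in_cbox_complex_iff in_box_complex_iff\<close>)
  hence I: "contour_integral R G = 2 * pi * \<i> * F z"
    using winding_number_rectpath[OF z] by (simp add: R_def contour_integral_unique)
  have contG: "continuous_on (S - {z}) G"
    unfolding G_def using assms(3)
    by (intro continuous_intros) (auto intro: holomorphic_on_imp_continuous_on continuous_on_subset)
  define s1 s2 s3 s4 where "s1 = linepath (Complex a c) (Complex b c)"
    and "s2 = linepath (Complex b c) (Complex b d)"
    and "s3 = linepath (Complex b d) (Complex a d)"
    and "s4 = linepath (Complex a d) (Complex a c)"
  have Rs: "R = s1 +++ s2 +++ s3 +++ s4"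
    by (simp add: R_def rectpath_def Let_def s1_def s2_def s3_def s4_def)
  have im: "path_image R = path_image s1 \<union> path_image s2 \<union> path_image s3 \<union> path_image s4"
    unfolding Rs by (subst path_image_join | simp add: s1_def s2_def s3_def s4_def Un_assoc)+
  have c: "continuous_on (closed_segment (Complex a c) (Complex b c)) G"
       "continuous_on (closed_segment (Complex b c) (Complex b d)) G"
       "continuous_on (closed_segment (Complex a d) (Complex b d)) G"
       "continuous_on (closed_segment (Complex a c) (Complex a d)) G"
    using R im by (auto intro!: continuous_on_subset[OF contG]
       simp: s1_def s2_def s3_def s4_def closed_segment_commute)
  have c': "continuous_on (closed_segment (Complex b d) (Complex a d)) G"
       "continuous_on (closed_segment (Complex a d) (Complex a c)) G"
    using c by (simp_all add: closed_segment_commute)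
  have ints: "G contour_integrable_on s1" "G contour_integrable_on s2"
     "G contour_integrable_on s3" "G contour_integrable_on s4"
    unfolding s1_def s2_def s3_def s4_def
    by (intro contour_integrable_continuous_linepath c c')+
  have "contour_integral R G = contour_integral s1 G + (contour_integral s2 G
      + (contour_integral s3 G + contour_integral s4 G))"
    unfolding Rs by (subst contour_integral_join | use ints in \<open>simp add: s1_def s2_def s3_def s4_def\<close>)+
  \<comment> \<open>The boundary path runs through the top and left sides backwards; reversing them
    lets an increasing coordinate parametrise all four sides.\<close>
  also have "contour_integral s3 G = - contour_integral (linepath (Complex a d) (Complex b d)) G"
    unfolding s3_def by (rule contour_integral_reverse_linepath[OF c'(1)])
  also have "contour_integral s4 G = - contour_integral (linepath (Complex a c) (Complex a d)) G"
    unfolding s4_def by (rule contour_integral_reverse_linepath[OF c'(2)])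
  finally have "2 * pi * norm (F z) \<le> norm (contour_integral s1 G)
     + norm (contour_integral (linepath (Complex a d) (Complex b d)) G)
     + norm (contour_integral (linepath (Complex a c) (Complex a d)) G) + norm (contour_integral s2 G)"
    (is "_ \<le> ?r") unfolding I
  proof -
    fix A B C D :: complex
    assume "2 * pi * \<i> * F z = A + (B + (- C + - D))"
    hence "norm (2 * pi * \<i> * F z) = norm ((A + B) - (C + D))"
      by (intro arg_cong[where f = norm]) (simp only: diff_conv_add_uminus minus_add_distrib ac_simps)
    also have "\<dots> \<le> norm A + norm C + norm D + norm B"
      using norm_triangle_ineq4[of "A + B" "C + D"] norm_triangle_ineq[of A B] norm_triangle_ineq[of C D]
      by linarith
    finally show "2 * pi * norm (F z) \<le> norm A + norm C + norm D + norm B"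
      by (simp add: norm_mult)
  qed
  hence "ennreal (2 * pi * norm (F z)) \<le> ennreal ?r" by (rule ennreal_leI)
  also have "\<dots> = ennreal (norm (contour_integral s1 G))
     + ennreal (norm (contour_integral (linepath (Complex a d) (Complex b d)) G))
     + ennreal (norm (contour_integral (linepath (Complex a c) (Complex a d)) G))
     + ennreal (norm (contour_integral s2 G))"
    by simp
  also have "\<dots> \<le> (\<integral>\<^sup>+ t. ennreal (norm (G (Complex t c))) * indicator {a..b} t \<partial>lborel)
    + (\<integral>\<^sup>+ t. ennreal (norm (G (Complex t d))) * indicator {a..b} t \<partial>lborel)
    + (\<integral>\<^sup>+ t. ennreal (norm (G (Complex a t))) * indicator {c..d} t \<partial>lborel)
    + (\<integral>\<^sup>+ t. ennreal (norm (G (Complex b t))) * indicator {c..d} t \<partial>lborel)"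
  proof (intro add_mono)
    have h: "\<i> * of_real y + of_real t * 1 = Complex t y" "of_real t + of_real y * \<i> = Complex t y" for t y
      by (simp_all add: Complex_eq)
    show "ennreal (norm (contour_integral s1 G)) \<le> (\<integral>\<^sup>+ t. ennreal (norm (G (Complex t c))) * indicator {a..b} t \<partial>lborel)"
      using norm_contour_integral_linepath_le[of a b 1 "\<i> * of_real c" G] less c unfolding h s1_def by simp
    show "ennreal (norm (contour_integral (linepath (Complex a d) (Complex b d)) G))
       \<le> (\<integral>\<^sup>+ t. ennreal (norm (G (Complex t d))) * indicator {a..b} t \<partial>lborel)"
      using norm_contour_integral_linepath_le[of a b 1 "\<i> * of_real d" G] less c unfolding h by simp
    show "ennreal (norm (contour_integral (linepath (Complex a c) (Complex a d)) G))
       \<le> (\<integral>\<^sup>+ t. ennreal (norm (G (Complex a t))) * indicator {c..d} t \<partial>lborel)"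
      using norm_contour_integral_linepath_le[of c d \<i> "of_real a" G] less c unfolding h by simp
    show "ennreal (norm (contour_integral s2 G)) \<le> (\<integral>\<^sup>+ t. ennreal (norm (G (Complex b t))) * indicator {c..d} t \<partial>lborel)"
      using norm_contour_integral_linepath_le[of c d \<i> "of_real b" G] less c unfolding h s2_def by simp
  qed
  finally show ?thesis by (simp add: G_def)
qed

lemma open_UHP: "open UHP" and convex_UHP: "convex UHP"
  unfolding UHP_def by (auto simp: open_halfspace_Im_gt convex_halfspace_Im_gt)

text \<open>Cauchy's formula is averaged over the concentric squares of half-side r with d \<le> r
  \<le> 2d, d = Im z / 4. As r varies, each of the four sides sweeps part of the largest square, so
  each contributes at most the full area integral I. Hence 2 pi |h(z)| d \<le> 4 I / d, and 32/pi
  \<le> 16 gives the constant. Squares keep the Fubini argument in Cartesian coordinates.\<close>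

lemma area_mean_value_bound:
  assumes hol: "h holomorphic_on UHP" and z: "z \<in> UHP"
  defines "q \<equiv> Complex (Im z / 2) (Im z / 2)"
  shows "ennreal (norm (h z)) \<le> ennreal (16 / (Im z)\<^sup>2) *
    (\<integral>\<^sup>+ w. ennreal (norm (h w)) * indicator (cbox (z - q) (z + q)) w \<partial>lborel)"
proof -
  define y d where "y = Im z" and "d = Im z / 4"
  have y: "y > 0" and d: "d > 0" "y = 4 * d" using z by (auto simp: y_def d_def UHP_def)
  define Q where "Q = cbox (z - q) (z + q)"
  have Q: "w \<in> Q \<longleftrightarrow> \<bar>Re w - Re z\<bar> \<le> 2 * d \<and> \<bar>Im w - y\<bar> \<le> 2 * d" for w
    
  proof -
    have "Re q = 2 * d" "Im q = 2 * d" by (simp_all add: q_def d_def)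
    thus ?thesis by (auto simp: Q_def in_cbox_complex_iff y_def abs_le_iff)
  qed
  have QU: "Q \<subseteq> UHP" using Q d by (fastforce simp: UHP_def)
  define H where "H = (\<lambda>w. ennreal (norm (h w)) * indicator Q w)"
  have [measurable]: "H \<in> borel_measurable borel"
    unfolding H_def using hol QU by (intro borel_measurable_continuous_on_ennreal continuous_intros)
      (auto simp: Q_def intro: holomorphic_on_imp_continuous_on holomorphic_on_subset)
  define A B where "A = (\<lambda>s. \<integral>\<^sup>+ t. H (Complex t s) \<partial>lborel)" and "B = (\<lambda>s. \<integral>\<^sup>+ t. H (Complex s t) \<partial>lborel)"
  have [measurable]: "A \<in> borel_measurable borel" "B \<in> borel_measurable borel"
    unfolding A_def B_def by measurable
  define I where "I = (\<integral>\<^sup>+ w. H w \<partial>lborel)"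
  have IA: "I = (\<integral>\<^sup>+ s. A s \<partial>lborel)"
    unfolding I_def A_def by (rule nn_integral_complex) measurable
  have "(\<integral>\<^sup>+ y. \<integral>\<^sup>+ x. H (Complex x y) \<partial>lborel \<partial>lborel) = (\<integral>\<^sup>+ x. \<integral>\<^sup>+ y. H (Complex x y) \<partial>lborel \<partial>lborel)"
    by (rule lborel_pair.Fubini') measurable
  hence IB: "I = (\<integral>\<^sup>+ s. B s \<partial>lborel)"
    unfolding IA by (simp add: A_def B_def)
  \<comment> \<open>Every point of a side satisfies |w - z| \<ge> r \<ge> d, so the Cauchy kernel is
    replaced by 1/d. The explicit factors -1 and 1 match the affine substitution used
    afterwards.\<close>
  have slice: "ennreal (2 * pi * norm (h z)) * indicator {d..2*d} r
      \<le> ennreal (1 / d) * (A (y + (-1) * r) + A (y + 1 * r) + B (Re z + (-1) * r) + B (Re z + 1 * r))" for r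
  proof (cases "r \<in> {d..2*d}")
    case True
    hence r: "d \<le> r" "r \<le> 2 * d" by auto
    have "ennreal (2 * pi * norm (h z)) \<le>
        (\<integral>\<^sup>+ t. ennreal (norm (h (Complex t (y - r)) / (Complex t (y - r) - z))) * indicator {Re z - r..Re z + r} t \<partial>lborel)
      + (\<integral>\<^sup>+ t. ennreal (norm (h (Complex t (y + r)) / (Complex t (y + r) - z))) * indicator {Re z - r..Re z + r} t \<partial>lborel)
      + (\<integral>\<^sup>+ t. ennreal (norm (h (Complex (Re z - r) t) / (Complex (Re z - r) t - z))) * indicator {y - r..y + r} t \<partial>lborel)
      + (\<integral>\<^sup>+ t. ennreal (norm (h (Complex (Re z + r) t) / (Complex (Re z + r) t - z))) * indicator {y - r..y + r} t \<partial>lborel)"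
    proof (rule Cauchy_rectangle_bound[OF open_UHP convex_UHP hol])
      have "cbox (Complex (Re z - r) (y - r)) (Complex (Re z + r) (y + r)) \<subseteq> Q"
        using r by (auto simp: Q in_cbox_complex_iff)
      thus "cbox (Complex (Re z - r) (y - r)) (Complex (Re z + r) (y + r)) \<subseteq> UHP" using QU by blast
      show "z \<in> box (Complex (Re z - r) (y - r)) (Complex (Re z + r) (y + r))"
        using r d by (auto simp: in_box_complex_iff y_def)
    qed
    also have "\<dots> \<le> (\<integral>\<^sup>+ t. ennreal (1 / d) * H (Complex t (y - r)) \<partial>lborel)
       + (\<integral>\<^sup>+ t. ennreal (1 / d) * H (Complex t (y + r)) \<partial>lborel)
       + (\<integral>\<^sup>+ t. ennreal (1 / d) * H (Complex (Re z - r) t) \<partial>lborel)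
       + (\<integral>\<^sup>+ t. ennreal (1 / d) * H (Complex (Re z + r) t) \<partial>lborel)"
    proof -
      have *: "ennreal (norm (h w / (w - z))) * indicator X t \<le> ennreal (1 / d) * H w"
        if "t \<in> X \<Longrightarrow> w \<in> Q" and "norm (w - z) \<ge> r" for w and X :: "real set" and t
      proof (cases "t \<in> X")
        case True
        have "norm (h w) / norm (w - z) \<le> norm (h w) / d"
          using that(2) r d by (intro divide_left_mono mult_pos_pos) auto
        thus ?thesis using True that(1) d
          by (simp add: H_def norm_divide ennreal_mult[symmetric] ennreal_leI)
      qed auto
      have w: "norm (Complex t (y - r) - z) \<ge> r" "norm (Complex t (y + r) - z) \<ge> r"
        "norm (Complex (Re z - r) t - z) \<ge> r" "norm (Complex (Re z + r) t - z) \<ge> r" for t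
        using abs_Im_le_cmod[of "Complex t (y - r) - z"] abs_Im_le_cmod[of "Complex t (y + r) - z"]
          abs_Re_le_cmod[of "Complex (Re z - r) t - z"] abs_Re_le_cmod[of "Complex (Re z + r) t - z"] r d
        by (auto simp: y_def)
      show ?thesis
        using r d by (intro add_mono nn_integral_mono * w) (auto simp: Q)
    qed
    also have "\<dots> = ennreal (1 / d) * (A (y - r) + A (y + r) + B (Re z - r) + B (Re z + r))"
      by (simp add: nn_integral_cmult A_def B_def distrib_left)
    finally show ?thesis using True by simp
  qed auto
  have "ennreal (2 * pi * norm (h z)) * ennreal d
     = (\<integral>\<^sup>+ r. ennreal (2 * pi * norm (h z)) * indicator {d..2*d} r \<partial>lborel)"
    using d by (subst nn_integral_cmult_indicator) auto
  also have "\<dots> \<le> (\<integral>\<^sup>+ r. ennreal (1 / d) * (A (y + (-1) * r) + A (y + 1 * r) + B (Re z + (-1) * r) + B (Re z + 1 * r)) \<partial>lborel)"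
    by (intro nn_integral_mono slice)
  also have "\<dots> = ennreal (1 / d) * ((\<integral>\<^sup>+ r. A (y + (-1) * r) \<partial>lborel) + (\<integral>\<^sup>+ r. A (y + 1 * r) \<partial>lborel)
      + (\<integral>\<^sup>+ r. B (Re z + (-1) * r) \<partial>lborel) + (\<integral>\<^sup>+ r. B (Re z + 1 * r) \<partial>lborel))"
    by (simp add: nn_integral_cmult nn_integral_add)
  also have "\<dots> = ennreal (1 / d) * (I + I + I + I)"
  proof -
    have shift: "(\<integral>\<^sup>+ r. f (s + c * r) \<partial>lborel) = (\<integral>\<^sup>+ r. f r \<partial>lborel)"
      if "f \<in> borel_measurable borel" "\<bar>c\<bar> = 1" for f :: "real \<Rightarrow> ennreal" and s c :: real
      using nn_integral_real_affine[OF that(1), of c s] that(2) by auto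
    show ?thesis
      using shift[of A "-1" y] shift[of A 1 y] shift[of B "-1" "Re z"] shift[of B 1 "Re z"]
      by (simp add: IA[symmetric] IB[symmetric])
  qed
  also have "I + I + I + I = 4 * I"
  proof -
    have "4 * I = ((1 + 1) + (1 + 1)) * I" by simp
    thus ?thesis by (simp only: distrib_right mult_1 add.assoc)
  qed
  finally have main: "ennreal (2 * pi * norm (h z)) * ennreal d \<le> ennreal (1 / d) * (4 * I)" .
  have "ennreal (norm (h z)) = ennreal (1 / (2 * pi * d)) * (ennreal (2 * pi * norm (h z)) * ennreal d)"
    using d by (simp add: ennreal_mult[symmetric] field_simps)
  also have "\<dots> \<le> ennreal (1 / (2 * pi * d)) * (ennreal (1 / d) * (ennreal 4 * I))"
    using main by (intro mult_left_mono) auto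
  also have "\<dots> = ennreal (1 / (2 * pi * d) * (1 / d) * 4) * I"
    using d by (subst ennreal_mult, simp, simp, subst ennreal_mult, simp, simp, simp only: mult.assoc)
  also have "\<dots> \<le> ennreal (16 / (Im z)\<^sup>2) * I"
    using d pi_gt3 by (intro mult_right_mono ennreal_leI)
      (auto simp: y_def[symmetric] power2_eq_square field_simps)
  finally show ?thesis unfolding I_def H_def Q_def .
qed

text \<open>With s = \<Phi>^{-1}(v) the two terms of \<open>affine_minorant\<close> balance: the
  square has area (Im z)^2, and s/v times the hypothesis is A s (Im z)^2. So |h| has mean at most (1
  + A) s over the square. The point estimates for Hardy and Bergman functions are both
  instances.\<close>

lemma (in U_function) pointwise_bound:
  assumes hol: "h holomorphic_on UHP" and z: "z \<in> UHP" and v: "v > 0" and A: "A \<ge> 0"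
  defines "q \<equiv> Complex (Im z / 2) (Im z / 2)"
  assumes int: "(\<integral>\<^sup>+ w. ennreal (\<Phi> (norm (h w))) * indicator (cbox (z - q) (z + q)) w \<partial>lborel)
    \<le> ennreal (A * (Im z)\<^sup>2 * v)"
  shows "norm (h z) \<le> 16 * (1 + A) * ginv \<Phi> v"
proof -
  define s y Q where "s = ginv \<Phi> v" and "y = Im z" and "Q = cbox (z - q) (z + q)"
  have s: "s > 0" "\<Phi> s = v" using v ginv_pos by (auto simp: s_def)
  have y: "y > 0" using z by (simp add: y_def UHP_def)
  have QU: "Q \<subseteq> UHP"
    using y by (auto simp: Q_def q_def in_cbox_complex_iff UHP_def y_def)
  have [measurable]: "(\<lambda>w. ennreal (\<Phi> (norm (h w))) * indicator Q w) \<in> borel_measurable borel"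
    using hol QU by (intro borel_measurable_continuous_on_ennreal continuous_on_comp continuous_intros)
      (auto simp: Q_def intro: holomorphic_on_imp_continuous_on holomorphic_on_subset)
  have "(\<integral>\<^sup>+ w. ennreal (norm (h w)) * indicator Q w \<partial>lborel)
     \<le> (\<integral>\<^sup>+ w. ennreal s * indicator Q w + ennreal (s / v) * (ennreal (\<Phi> (norm (h w))) * indicator Q w) \<partial>lborel)"
  proof (rule nn_integral_mono)
    fix w
    have "ennreal (norm (h w)) \<le> ennreal s + ennreal (s / v) * ennreal (\<Phi> (norm (h w)))"
      using affine_minorant[of s "norm (h w)"] s v nonneg[of "norm (h w)"]
      by (simp add: ennreal_mult[symmetric] ennreal_plus[symmetric] ennreal_leI del: ennreal_plus)
    thus "ennreal (norm (h w)) * indicator Q w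
        \<le> ennreal s * indicator Q w + ennreal (s / v) * (ennreal (\<Phi> (norm (h w))) * indicator Q w)"
      by (auto simp: indicator_def)
  qed
  also have "\<dots> = ennreal s * emeasure lborel Q
      + ennreal (s / v) * (\<integral>\<^sup>+ w. ennreal (\<Phi> (norm (h w))) * indicator Q w \<partial>lborel)"
  proof -
    have [measurable]: "Q \<in> sets borel" by (simp add: Q_def)
    show ?thesis by (subst nn_integral_add) (auto simp: nn_integral_cmult nn_integral_cmult_indicator)
  qed
  also have "emeasure lborel Q = ennreal (y\<^sup>2)"
    using y unfolding Q_def
    by (subst emeasure_lborel_cbox_eq) (auto simp: Basis_complex_def q_def y_def power2_eq_square)
  also have "ennreal s * ennreal (y\<^sup>2) + ennreal (s / v) * (\<integral>\<^sup>+ w. ennreal (\<Phi> (norm (h w))) * indicator Q w \<partial>lborel)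
     \<le> ennreal s * ennreal (y\<^sup>2) + ennreal (s / v) * ennreal (A * y\<^sup>2 * v)"
    using int by (intro add_left_mono mult_left_mono) (auto simp: Q_def y_def)
  also have "\<dots> = ennreal (s * y\<^sup>2 * (1 + A))"
    using s v A by (simp add: ennreal_mult[symmetric] ennreal_plus[symmetric] field_simps del: ennreal_plus)
  finally have "ennreal (16 / y\<^sup>2) * (\<integral>\<^sup>+ w. ennreal (norm (h w)) * indicator Q w \<partial>lborel)
      \<le> ennreal (16 / y\<^sup>2) * ennreal (s * y\<^sup>2 * (1 + A))"
    by (intro mult_left_mono) auto
  also have "\<dots> = ennreal (16 * (1 + A) * s)"
    using y s A by (simp add: ennreal_mult[symmetric])
  finally have "ennreal (norm (h z)) \<le> ennreal (16 * (1 + A) * s)"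
    using area_mean_value_bound[OF hol z] unfolding Q_def q_def y_def by (rule order.trans[rotated])
  thus ?thesis using s A by (simp add: s_def)
qed

text \<open>The Cauchy formula is applied to f multiplied by a function whose pole is the mirror image of z
  in the line Im w = e; this turns the Cauchy kernel into the Poisson kernel on that line.\<close>

lemma Poisson_bound:
  assumes hol: "f holomorphic_on UHP" and e: "0 < e" and z: "e < Im z"
    and bd: "\<And>w. e \<le> Im w \<Longrightarrow> norm (f w) \<le> B"
  defines "y \<equiv> Im z - e"
  shows "ennreal (2 * pi * norm (f z)) \<le>
    (\<integral>\<^sup>+ t. ennreal (norm (f (Complex t e))) * ennreal (2 * y / ((t - Re z)\<^sup>2 + y\<^sup>2)) \<partial>lborel)"
    (is "_ \<le> ?P")
proof (rule ennreal_le_epsilon)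
  fix r :: real assume r: "r > 0"
  have y: "y > 0" using z by (simp add: y_def)
  have B: "B \<ge> 0" using order.trans[OF norm_ge_zero bd[of "Complex 0 e"]] by simp
  define z' where "z' = Complex (Re z) (e - y)"
  define F where "F = (\<lambda>w. f w * (2 * \<i> * of_real y / (w - z')))"
  \<comment> \<open>S contains the closed rectangle but not the pole z', whose imaginary part is e -
    y; the maximum with 0 keeps S inside \<open>UHP\<close>.\<close>
  define S where "S = {w. max 0 (e - y) < Im w}"
  \<comment> \<open>R \<ge> 2y puts the top side at distance at least R/2 from z. The top then
    contributes at most 8By/R and each vertical side 2By/R, together 12By/R \<le> r.\<close>
  define R where "R = max (2 * y) (12 * B * y / r)"
  have R: "R \<ge> 2 * y" "12 * B * y / r \<le> R" "R > 0" using y by (auto simp: R_def less_max_iff_disj)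
  have zz: "z - z' = 2 * \<i> * of_real y"
    by (simp add: complex_eq_iff z'_def y_def)
  have Fz: "F z = f z" using y by (simp add: F_def zz)
  have "F holomorphic_on S"
    unfolding F_def S_def using hol
    by (intro holomorphic_intros) (auto simp: z'_def UHP_def intro: holomorphic_on_subset)
  have kernel: "norm (F w / (w - z)) = norm (f w) * (2 * y / (norm (w - z) * norm (w - z')))" for w
    using y by (simp add: F_def norm_mult norm_divide mult.commute)
  have bound: "norm (F w / (w - z)) \<le> B * (2 * y / (c * c'))"
    if "0 < c" "0 < c'" "c \<le> norm (w - z)" "c' \<le> norm (w - z')" "e \<le> Im w" for w c c'
    unfolding kernel using that y B
    by (intro mult_mono bd divide_left_mono mult_pos_pos) auto
  have "ennreal (2 * pi * norm (F z)) \<le>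
      (\<integral>\<^sup>+ t. ennreal (norm (F (Complex t e) / (Complex t e - z))) * indicator {Re z - R..Re z + R} t \<partial>lborel)
    + (\<integral>\<^sup>+ t. ennreal (norm (F (Complex t (e + R)) / (Complex t (e + R) - z))) * indicator {Re z - R..Re z + R} t \<partial>lborel)
    + (\<integral>\<^sup>+ t. ennreal (norm (F (Complex (Re z - R) t) / (Complex (Re z - R) t - z))) * indicator {e..e + R} t \<partial>lborel)
    + (\<integral>\<^sup>+ t. ennreal (norm (F (Complex (Re z + R) t) / (Complex (Re z + R) t - z))) * indicator {e..e + R} t \<partial>lborel)"
  proof (rule Cauchy_rectangle_bound)
    show "open S" "convex S" unfolding S_def by (auto simp: open_halfspace_Im_gt convex_halfspace_Im_gt simp del: max_less_iff_conj)
    show "F holomorphic_on S" by fact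
    show "cbox (Complex (Re z - R) e) (Complex (Re z + R) (e + R)) \<subseteq> S"
      using e y by (auto simp: S_def in_cbox_complex_iff)
    show "z \<in> box (Complex (Re z - R) e) (Complex (Re z + R) (e + R))"
      using R y z by (auto simp: in_box_complex_iff y_def)
  qed
  also have "\<dots> \<le> ?P + (\<integral>\<^sup>+ t. ennreal (B * (2 * y / (R / 2 * R))) * indicator {Re z - R..Re z + R} t \<partial>lborel)
    + (\<integral>\<^sup>+ t. ennreal (B * (2 * y / (R * R))) * indicator {e..e + R} t \<partial>lborel)
    + (\<integral>\<^sup>+ t. ennreal (B * (2 * y / (R * R))) * indicator {e..e + R} t \<partial>lborel)"
  proof (intro add_mono nn_integral_mono)
    fix t
    \<comment> \<open>Points of the line are equidistant from z and its mirror image, so the two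
      distances multiply to the Poisson denominator.\<close>
    have "norm (Complex t e - z) = sqrt ((t - Re z)\<^sup>2 + y\<^sup>2)" "norm (Complex t e - z') = sqrt ((t - Re z)\<^sup>2 + y\<^sup>2)"
      by (simp_all add: cmod_def z'_def y_def power2_commute)
    hence "norm (F (Complex t e) / (Complex t e - z)) = norm (f (Complex t e)) * (2 * y / ((t - Re z)\<^sup>2 + y\<^sup>2))"
      unfolding kernel by simp
    thus "ennreal (norm (F (Complex t e) / (Complex t e - z))) * indicator {Re z - R..Re z + R} t
      \<le> ennreal (norm (f (Complex t e))) * ennreal (2 * y / ((t - Re z)\<^sup>2 + y\<^sup>2))"
      using y by (auto simp: indicator_def ennreal_mult[symmetric])
    have "R / 2 \<le> norm (Complex t (e + R) - z)" "R \<le> norm (Complex t (e + R) - z')"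
      using abs_Im_le_cmod[of "Complex t (e + R) - z"] abs_Im_le_cmod[of "Complex t (e + R) - z'"] R y
      by (auto simp: z'_def y_def)
    thus "ennreal (norm (F (Complex t (e + R)) / (Complex t (e + R) - z))) * indicator {Re z - R..Re z + R} t
      \<le> ennreal (B * (2 * y / (R / 2 * R))) * indicator {Re z - R..Re z + R} t"
      using R by (intro mult_right_mono ennreal_leI bound) auto
    have 1: "R \<le> norm (Complex (Re z + s) t - z)" "R \<le> norm (Complex (Re z + s) t - z')" if "\<bar>s\<bar> = R" for s
      using abs_Re_le_cmod[of "Complex (Re z + s) t - z"] abs_Re_le_cmod[of "Complex (Re z + s) t - z'"] that
      by (auto simp: z'_def)
    show "ennreal (norm (F (Complex (Re z + R) t) / (Complex (Re z + R) t - z))) * indicator {e..e + R} t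
      \<le> ennreal (B * (2 * y / (R * R))) * indicator {e..e + R} t"
      using R 1[of R] by (cases "t \<in> {e..e + R}") (auto intro!: ennreal_leI bound simp del: times_divide_eq_right)
    show "ennreal (norm (F (Complex (Re z - R) t) / (Complex (Re z - R) t - z))) * indicator {e..e + R} t
      \<le> ennreal (B * (2 * y / (R * R))) * indicator {e..e + R} t"
      using R 1[of "- R"] by (cases "t \<in> {e..e + R}") (auto intro!: ennreal_leI bound simp del: times_divide_eq_right)
  qed
  also have "\<dots> = ?P + ennreal (12 * B * y / R)"
  proof -
    have const: "(\<integral>\<^sup>+ t. ennreal k * indicator {a..b} t \<partial>lborel) = ennreal (k * (b - a))"
      if "k \<ge> 0" "a \<le> b" for k a b :: real
      using that by (subst nn_integral_cmult_indicator) (auto simp: ennreal_mult)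
    have nn: "B * (2 * y / (R / 2 * R)) \<ge> 0" "B * (2 * y / (R * R)) \<ge> 0" using R y B by auto
    have "B * (2 * y / (R / 2 * R)) * (Re z + R - (Re z - R)) + B * (2 * y / (R * R)) * (e + R - e)
        + B * (2 * y / (R * R)) * (e + R - e) = 12 * B * y / R"
      using R by (simp add: field_simps)
    moreover have "P + ennreal a + ennreal b + ennreal b = P + ennreal (a + b + b)" if "a \<ge> 0" "b \<ge> 0" for P a b
      using that by (simp only: add.assoc ennreal_plus add_nonneg_nonneg)
    moreover have "Re z - R \<le> Re z + R" "e \<le> e + R" using R by auto
    moreover have "B * (2 * y / (R / 2 * R)) * (Re z + R - (Re z - R)) \<ge> 0"
        "B * (2 * y / (R * R)) * (e + R - e) \<ge> 0" using B y R by auto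
    ultimately show ?thesis
      using nn by (simp only: const)
  qed
  also have "\<dots> \<le> ?P + ennreal r"
    using R r by (intro add_left_mono ennreal_leI) (simp add: field_simps)
  finally show "ennreal (2 * pi * norm (f z)) \<le> ?P + ennreal r" unfolding Fz .
qed

text \<open>The kernel is dominated by a sum of indicators of the balls of radius 2^k y with
  coefficients 8/(y 4^k). An average bound l on each ball gives 16 l / 2^k, which sums to 32
  l.\<close>

lemma Poisson_kernel_le_average:
  fixes u :: "real \<Rightarrow> ennreal"
  assumes [measurable]: "u \<in> borel_measurable borel" and y: "y > 0" and l: "l \<ge> 0"
    and avg: "\<And>r. r > 0 \<Longrightarrow> (\<integral>\<^sup>+ t. u t * indicator (cball x r) t \<partial>lborel) \<le> ennreal (2 * r * l)"
  shows "(\<integral>\<^sup>+ t. u t * ennreal (2 * y / ((t - x)\<^sup>2 + y\<^sup>2)) \<partial>lborel) \<le> ennreal (32 * l)"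
proof -
  have [measurable]: "cball x r \<in> sets borel" for r by simp
  define c where "c = (\<lambda>k::nat. ennreal (8 / y * (1 / 4) ^ k))"
  have le: "ennreal (2 * y / ((t - x)\<^sup>2 + y\<^sup>2)) \<le> (\<Sum>k. c k * indicator (cball x (2 ^ k * y)) t)" for t
  proof -
    define s where "s = \<bar>t - x\<bar>"
    have "\<exists>k::nat. s / y < 2 ^ k" by (intro real_arch_pow) simp
    hence ex: "\<exists>k::nat. s \<le> 2 ^ k * y" using y by (auto simp: field_simps intro: less_imp_le)
    \<comment> \<open>The first dyadic ball that contains t. For k > 0 the distance exceeds 2^(k-1)
      y, so the kernel is at most 2 / (4^(k-1) y); this is the origin of 8.\<close>
    define k where "k = (LEAST k::nat. s \<le> 2 ^ k * y)"
    have k: "s \<le> 2 ^ k * y" unfolding k_def using ex by (rule LeastI_ex)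
    have "2 * y / (s\<^sup>2 + y\<^sup>2) \<le> 8 / y * (1 / 4) ^ k"
    proof (cases k)
      case 0
      have "2 * y / (s\<^sup>2 + y\<^sup>2) \<le> 2 * y / y\<^sup>2" using y by (intro divide_left_mono mult_pos_pos add_nonneg_pos) auto
      also have "\<dots> \<le> 8 / y" using y by (simp add: power2_eq_square field_simps)
      finally show ?thesis using 0 by simp
    next
      case (Suc m)
      hence "2 ^ m * y \<le> s"
        using not_less_Least[of m "\<lambda>k. s \<le> 2 ^ k * y"] by (simp add: k_def)
      hence "(2 ^ m * y)\<^sup>2 \<le> s\<^sup>2" using y by (intro power_mono) auto
      hence "2 * y / (s\<^sup>2 + y\<^sup>2) \<le> 2 * y / (2 ^ m * y)\<^sup>2"
        using y by (intro divide_left_mono mult_pos_pos add_nonneg_pos) (auto simp: add_increasing2)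
      also have "\<dots> = 8 / y * (1 / 4) ^ k"
      proof -
        have "(2 ^ m :: real)\<^sup>2 = (2\<^sup>2) ^ m" by (simp only: power_mult[symmetric] mult.commute)
        hence "(2 ^ m :: real)\<^sup>2 = 4 ^ m" by simp
        thus ?thesis using y by (simp add: Suc power_mult_distrib power_divide power2_eq_square field_simps)
      qed
      finally show ?thesis .
    qed
    moreover have "t \<in> cball x (2 ^ k * y)" using k by (simp add: s_def dist_real_def abs_minus_commute)
    ultimately have "ennreal (2 * y / ((t - x)\<^sup>2 + y\<^sup>2)) \<le> c k * indicator (cball x (2 ^ k * y)) t"
      by (simp add: c_def s_def ennreal_leI)
    also have "\<dots> \<le> (\<Sum>k. c k * indicator (cball x (2 ^ k * y)) t)"
      using sum_le_suminf[of "\<lambda>k. c k * indicator (cball x (2 ^ k * y)) t" "{k}"]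
      by (simp only: sum_clauses finite.emptyI empty_iff if_False add_0_right summableI finite.insertI zero_le simp_thms)
    finally show ?thesis .
  qed
  have "(\<integral>\<^sup>+ t. u t * ennreal (2 * y / ((t - x)\<^sup>2 + y\<^sup>2)) \<partial>lborel)
      \<le> (\<integral>\<^sup>+ t. (\<Sum>k. c k * (u t * indicator (cball x (2 ^ k * y)) t)) \<partial>lborel)"
  proof (rule nn_integral_mono)
    fix t
    have "u t * ennreal (2 * y / ((t - x)\<^sup>2 + y\<^sup>2)) \<le> u t * (\<Sum>k. c k * indicator (cball x (2 ^ k * y)) t)"
      by (intro mult_left_mono le) simp
    also have "\<dots> = (\<Sum>k. c k * (u t * indicator (cball x (2 ^ k * y)) t))"
      by (subst ennreal_suminf_cmult[symmetric]) (simp add: ac_simps)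
    finally show "u t * ennreal (2 * y / ((t - x)\<^sup>2 + y\<^sup>2))
      \<le> (\<Sum>k. c k * (u t * indicator (cball x (2 ^ k * y)) t))" .
  qed
  also have "\<dots> = (\<Sum>k. c k * (\<integral>\<^sup>+ t. u t * indicator (cball x (2 ^ k * y)) t \<partial>lborel))"
    by (subst nn_integral_suminf) (auto simp: nn_integral_cmult)
  also have "\<dots> \<le> (\<Sum>k. c k * ennreal (2 * (2 ^ k * y) * l))"
    using y by (intro suminf_le summableI mult_left_mono avg) auto
  also have "\<dots> = (\<Sum>k. ennreal (16 * l * (1 / 2) ^ k))"
  proof (rule arg_cong[where f = suminf], rule ext)
    fix k
    have "(1 / 4 :: real) ^ k * 2 ^ k = (1 / 2) ^ k" by (simp add: power_mult_distrib[symmetric])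
    hence "8 / y * (1 / 4) ^ k * (2 * (2 ^ k * y) * l) = 16 * l * (1 / 2) ^ k" using y by (simp add: field_simps)
    thus "c k * ennreal (2 * (2 ^ k * y) * l) = ennreal (16 * l * (1 / 2) ^ k)"
      using y l unfolding c_def by (subst ennreal_mult[symmetric]) auto
  qed
  also have "\<dots> = ennreal (32 * l)"
  proof (rule suminf_ennreal_eq)
    show "(\<lambda>k. 16 * l * (1 / 2) ^ k) sums (32 * l)"
      using sums_mult[OF geometric_sums[of "1 / 2 :: real"], of "16 * l"] by simp
  qed (use l in auto)
  finally show ?thesis .
qed

text \<open>On a ball where u has average above l, the values up to l/2 account for at most half of
  the integral, so the part of u above l/2 still has mass more than r l. Vitali's lemma selects
  disjoint balls whose fivefold enlargements, of length 10 r = (10/l) (r l), cover E. The truncation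
  at l/2 is what later permits integration over all levels.\<close>

lemma Hardy_Littlewood_weak_type:
  fixes u :: "real \<Rightarrow> real"
  assumes [measurable]: "u \<in> borel_measurable borel" "E \<in> sets borel" and l: "l > 0" and u: "\<And>t. u t \<ge> 0"
    and E: "\<And>x. x \<in> E \<Longrightarrow> \<exists>r>0. ennreal (2 * r * l) < (\<integral>\<^sup>+ t. ennreal (u t) * indicator (cball x r) t \<partial>lborel)"
  shows "emeasure lborel E \<le> ennreal (10 / l) * (\<integral>\<^sup>+ t. ennreal (u t) * indicator {t. l / 2 < u t} t \<partial>lborel)"
proof -
  have [measurable]: "cball x r \<in> sets borel" for x r :: real by simp
  define v where "v = (\<lambda>t. ennreal (u t) * indicator {t. l / 2 < u t} t)"
  have [measurable]: "v \<in> borel_measurable borel" unfolding v_def by measurable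
  define I where "I = (\<integral>\<^sup>+ t. v t \<partial>lborel)"
  show ?thesis
  proof (cases "I = \<infinity>")
    case True
    thus ?thesis using l by (simp add: I_def v_def ennreal_mult_top)
  next
    case False
    then obtain J where J: "J \<ge> 0" "I = ennreal J" by (cases I) auto
    have "\<forall>x\<in>E. \<exists>r>0. ennreal (r * l) < (\<integral>\<^sup>+ t. v t * indicator (cball x r) t \<partial>lborel)"
    proof
      fix x assume "x \<in> E"
      then obtain r where r: "r > 0" "ennreal (2 * r * l) < (\<integral>\<^sup>+ t. ennreal (u t) * indicator (cball x r) t \<partial>lborel)"
        using E by blast
      note r(2)
      also have "(\<integral>\<^sup>+ t. ennreal (u t) * indicator (cball x r) t \<partial>lborel)
         \<le> (\<integral>\<^sup>+ t. ennreal (l / 2) * indicator (cball x r) t + v t * indicator (cball x r) t \<partial>lborel)"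
        using u by (intro nn_integral_mono) (auto simp: v_def indicator_def not_less intro!: ennreal_leI)
      also have "\<dots> = ennreal (l / 2) * emeasure lborel (cball x r) + (\<integral>\<^sup>+ t. v t * indicator (cball x r) t \<partial>lborel)"
        by (subst nn_integral_add) (auto simp: nn_integral_cmult_indicator)
      also have "ennreal (l / 2) * emeasure lborel (cball x r) = ennreal (r * l)"
        using r l by (simp add: cball_eq_atLeastAtMost ennreal_mult[symmetric])
      finally have "ennreal (2 * r * l) < ennreal (r * l) + (\<integral>\<^sup>+ t. v t * indicator (cball x r) t \<partial>lborel)" .
      moreover have "ennreal (2 * r * l) = ennreal (r * l) + ennreal (r * l)"
        using r l by (simp add: ennreal_plus[symmetric] del: ennreal_plus)
      ultimately show "\<exists>r>0. ennreal (r * l) < (\<integral>\<^sup>+ t. v t * indicator (cball x r) t \<partial>lborel)"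
        using r(1) by (metis add_left_mono not_less)
    qed
    then obtain r where r: "\<And>x. x \<in> E \<Longrightarrow> r x > 0"
        "\<And>x. x \<in> E \<Longrightarrow> ennreal (r x * l) < (\<integral>\<^sup>+ t. v t * indicator (cball x (r x)) t \<partial>lborel)"
      by metis
    \<comment> \<open>Vitali's lemma needs bounded radii; since r l cannot exceed the total mass J,
      finiteness of I provides the bound.\<close>
    have rB: "0 < r x \<and> r x \<le> J / l" if "x \<in> E" for x
    proof -
      have "ennreal (r x * l) \<le> (\<integral>\<^sup>+ t. v t * indicator (cball x (r x)) t \<partial>lborel)" using r(2)[OF that] by simp
      also have "\<dots> \<le> I" unfolding I_def by (intro nn_integral_mono) (auto simp: indicator_def)
      finally have "r x * l \<le> J" unfolding J using J l by simp
      thus ?thesis using r(1)[OF that] l by (simp add: field_simps)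
    qed
    have "E \<subseteq> (\<Union>x\<in>E. cball x (r x))" using r(1) by (force intro: less_imp_le)
    then obtain C where C: "countable C" "C \<subseteq> E"
      "pairwise (\<lambda>i j. disjnt (cball i (r i)) (cball j (r j))) C"
      "E \<subseteq> (\<Union>i\<in>C. cball i (5 * r i))"
      by (rule Vitali_covering_lemma_cballs[where a = "\<lambda>x. x" and r = r and B = "J / l"]) (use rB in auto)
    \<comment> \<open>With the truncated function as a density, the masses of the disjoint balls add
      up by countable additivity.\<close>
    define D where "D = density lborel v"
    have D: "emeasure D (cball x (r x)) = (\<integral>\<^sup>+ t. v t * indicator (cball x (r x)) t \<partial>lborel)" for x
      by (simp add: D_def emeasure_density)
    have "emeasure lborel E \<le> emeasure lborel (\<Union>i\<in>C. cball i (5 * r i))"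
      using C by (intro emeasure_mono) (auto intro!: sets.countable_UN')
    also have "\<dots> \<le> (\<integral>\<^sup>+ i. emeasure lborel (cball i (5 * r i)) \<partial>count_space C)"
    proof (cases "C = {}")
      case False
      have "indicator (\<Union>i\<in>C. cball i (5 * r i)) x \<le> (\<integral>\<^sup>+ i. indicator (cball i (5 * r i)) x \<partial>count_space C)" for x
      proof (cases "x \<in> (\<Union>i\<in>C. cball i (5 * r i))")
        case True
        then obtain i where i: "i \<in> C" "x \<in> cball i (5 * r i)" by blast
        have "(1::ennreal) = (\<integral>\<^sup>+ j. indicator {i} j \<partial>count_space C)"
          using i by (simp add: emeasure_count_space)
        also have "\<dots> \<le> (\<integral>\<^sup>+ i. indicator (cball i (5 * r i)) x \<partial>count_space C)"
          using i by (intro nn_integral_mono) (auto simp: indicator_def)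
        finally show ?thesis using True by simp
      qed auto
      hence "emeasure lborel (\<Union>i\<in>C. cball i (5 * r i))
         \<le> (\<integral>\<^sup>+ x. (\<integral>\<^sup>+ i. indicator (cball i (5 * r i)) x \<partial>count_space C) \<partial>lborel)"
        using C by (subst nn_integral_indicator[symmetric])
          (auto intro!: nn_integral_mono sets.countable_UN')
      also have "\<dots> = (\<integral>\<^sup>+ i. (\<integral>\<^sup>+ x. indicator (cball i (5 * r i)) x \<partial>lborel) \<partial>count_space C)"
        using C by (subst nn_integral_count_space_nn_integral) auto
      finally show ?thesis by simp
    qed auto
    also have "\<dots> \<le> (\<integral>\<^sup>+ i. ennreal (10 / l) * emeasure D (cball i (r i)) \<partial>count_space C)"
    proof (rule nn_integral_mono)
      fix i assume "i \<in> space (count_space C)"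
      hence i: "i \<in> E" using C by auto
      have "emeasure lborel (cball i (5 * r i)) = ennreal (10 / l) * ennreal (r i * l)"
        using r(1)[OF i] l by (simp add: cball_eq_atLeastAtMost ennreal_mult[symmetric])
      also have "\<dots> \<le> ennreal (10 / l) * emeasure D (cball i (r i))"
        unfolding D using r(2)[OF i] by (intro mult_left_mono) auto
      finally show "emeasure lborel (cball i (5 * r i)) \<le> ennreal (10 / l) * emeasure D (cball i (r i))" .
    qed
    also have "\<dots> = ennreal (10 / l) * emeasure D (\<Union>i\<in>C. cball i (r i))"
    proof -
      have "emeasure D (\<Union>i\<in>C. cball i (r i)) = (\<integral>\<^sup>+ i. emeasure D (cball i (r i)) \<partial>count_space C)"
        using C by (intro emeasure_UN_countable)
          (auto simp: D_def disjoint_family_on_def pairwise_def disjnt_def)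
      thus ?thesis by (simp add: nn_integral_cmult)
    qed
    also have "\<dots> \<le> ennreal (10 / l) * I"
    proof -
      have "emeasure D (\<Union>i\<in>C. cball i (r i)) \<le> emeasure D UNIV"
        using C by (intro emeasure_mono) (auto simp: D_def)
      also have "\<dots> = I" by (simp add: D_def emeasure_density I_def)
      finally show ?thesis by (intro mult_left_mono) auto
    qed
    finally show ?thesis by (simp add: I_def v_def)
  qed
qed

section \<open>The maximal function of a Hardy-Orlicz function\<close>

text \<open>Equivalently, F(t) / t^(1+\<delta>) is nondecreasing up to the factor C. For \<delta> >
  0 this makes F(s)/s^2 integrable at 0, with integral over (0,t) at most (C/\<delta>)
  F(t)/t.\<close>

definition lower_type :: "real \<Rightarrow> real \<Rightarrow> (real \<Rightarrow> real) \<Rightarrow> bool" where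
  "lower_type \<delta> C F \<longleftrightarrow> (\<forall>s t. 0 < s \<longrightarrow> s \<le> t \<longrightarrow> F s / s \<le> C * (s / t) powr \<delta> * (F t / t))"

text \<open>The hypothesis on K says that F(x)/x at least doubles when x is multiplied by K, so it
  grows at least like the power \<delta> = log_K 2. Between powers of K the monotone ratio is used;
  this rounding costs the factor 2.\<close>

lemma lower_typeI:
  assumes ratio: "\<And>s t. 0 < s \<Longrightarrow> s \<le> t \<Longrightarrow> F s / s \<le> F t / t"
    and pos: "\<And>s. 0 < s \<Longrightarrow> 0 < F s"
    and K: "K > 1" "\<And>x. 0 < x \<Longrightarrow> 2 * K * F x \<le> F (K * x)"
  obtains \<delta> where "\<delta> > 0" "lower_type \<delta> 2 F"
proof -
  define \<delta> where "\<delta> = log K 2"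
  have \<delta>: "\<delta> > 0" "K powr \<delta> = 2" using K by (auto simp: \<delta>_def)
  have pow: "2 ^ n * (F s / s) \<le> F (K ^ n * s) / (K ^ n * s)" if "s > 0" for n s
  proof (induction n)
    case (Suc n)
    have p: "K ^ n * s > 0" using K that by simp
    have "2 ^ Suc n * (F s / s) \<le> 2 * (F (K ^ n * s) / (K ^ n * s))" using Suc by simp
    also have "\<dots> \<le> F (K * (K ^ n * s)) / (K * (K ^ n * s))"
      using K(2)[OF p] K(1) p that by (simp add: field_simps)
    finally show ?case by (simp add: mult.assoc)
  qed auto
  have "F s / s \<le> 2 * (s / t) powr \<delta> * (F t / t)" if st: "0 < s" "s \<le> t" for s t
  proof -
    have "\<exists>n. t / s < K ^ n" using K by (intro real_arch_pow) auto
    hence ex: "\<exists>n. t < K ^ n * s" using st by (auto simp: field_simps)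
    \<comment> \<open>The first exponent with K^m s beyond t. The ratios are compared at its
      predecessor n, while (t/s)^\<delta> is bounded by 2^m = 2 * 2^n.\<close>
    define m where "m = (LEAST n. t < K ^ n * s)"
    have m: "t < K ^ m * s" unfolding m_def using ex by (rule LeastI_ex)
    hence "m \<noteq> 0" using st by (intro notI) auto
    then obtain n where n: "m = Suc n" by (cases m) auto
    hence "K ^ n * s \<le> t" using not_less_Least[of n "\<lambda>n. t < K ^ n * s"] by (auto simp: m_def)
    hence "F (K ^ n * s) / (K ^ n * s) \<le> F t / t" using K st by (intro ratio) auto
    hence 1: "2 ^ n * (F s / s) \<le> F t / t" using pow[OF st(1), of n] by linarith
    have "(t / s) powr \<delta> \<le> (K ^ m) powr \<delta>" using m st \<delta> by (intro powr_mono2) (auto simp: field_simps)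
    also have "(K ^ m) powr \<delta> = (K powr \<delta>) ^ m"
      using K(1) by (simp add: powr_realpow[symmetric] powr_powr mult.commute)
    also have "\<dots> = 2 ^ m" using \<delta> by simp
    finally have "(t / s) powr \<delta> * (F s / s) \<le> 2 ^ m * (F s / s)"
      using st pos[of s] by (intro mult_right_mono) auto
    also have "\<dots> \<le> 2 * (F t / t)" using 1 n by simp
    finally have "(t / s) powr \<delta> * (F s / s) \<le> 2 * (F t / t)" .
    hence "(s / t) powr \<delta> * ((t / s) powr \<delta> * (F s / s)) \<le> (s / t) powr \<delta> * (2 * (F t / t))"
      by (intro mult_left_mono) auto
    moreover have "(s / t) powr \<delta> * (t / s) powr \<delta> = 1"
      using st by (simp add: powr_divide)
    hence "(s / t) powr \<delta> * ((t / s) powr \<delta> * (F s / s)) = F s / s"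
      by (simp only: mult.assoc[symmetric] mult_1_left)
    ultimately show ?thesis by (simp only: mult_ac)
  qed
  thus ?thesis using \<delta>(1) that by (auto simp: lower_type_def)
qed

section \<open>Two power integrals for the layer-cake and vertical-line estimates\<close>

lemma nn_integral_powr:
  assumes "\<delta> > 0" "c \<ge> 0"
  shows "(\<integral>\<^sup>+ s. ennreal (s powr (\<delta> - 1)) * indicator {0..c} s \<partial>lborel) = ennreal (c powr \<delta> / \<delta>)"
proof -
  have "((\<lambda>s. s powr (\<delta> - 1)) has_integral (c powr \<delta> / \<delta>)) {0..c}"
    using has_integral_powr_from_0[of "\<delta> - 1" c] assms by simp
  hence "((\<lambda>s. if s \<in> {0..c} then s powr (\<delta> - 1) else 0) has_integral (c powr \<delta> / \<delta>)) UNIV"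
    by (simp only: has_integral_restrict_UNIV)
  hence "(\<integral>\<^sup>+ s. ennreal (if s \<in> {0..c} then s powr (\<delta> - 1) else 0) \<partial>lborel) = ennreal (c powr \<delta> / \<delta>)"
    by (intro nn_integral_has_integral_lborel) auto
  also have "(\<integral>\<^sup>+ s. ennreal (if s \<in> {0..c} then s powr (\<delta> - 1) else 0) \<partial>lborel)
      = (\<integral>\<^sup>+ s. ennreal (s powr (\<delta> - 1)) * indicator {0..c} s \<partial>lborel)"
    by (intro nn_integral_cong) (auto simp: indicator_def)
  finally show ?thesis .
qed

lemma nn_integral_inverse_square:
  assumes "a > 0"
  shows "(\<integral>\<^sup>+ s. ennreal (s powr - 2) * indicator {a..} s \<partial>lborel) = ennreal (1 / a)"
proof -
  have "((\<lambda>s. s powr - 2) has_integral (1 / a)) {a..}"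
    using has_integral_powr_to_inf[of "- 2" a] assms by (simp add: powr_minus field_simps)
  hence "((\<lambda>s. if s \<in> {a..} then s powr - 2 else 0) has_integral (1 / a)) UNIV"
    by (simp only: has_integral_restrict_UNIV)
  hence "(\<integral>\<^sup>+ s. ennreal (if s \<in> {a..} then s powr - 2 else 0) \<partial>lborel) = ennreal (1 / a)"
    by (intro nn_integral_has_integral_lborel) auto
  also have "(\<integral>\<^sup>+ s. ennreal (if s \<in> {a..} then s powr - 2 else 0) \<partial>lborel)
      = (\<integral>\<^sup>+ s. ennreal (s powr - 2) * indicator {a..} s \<partial>lborel)"
    by (intro nn_integral_cong) (auto simp: indicator_def)
  finally show ?thesis .
qed

context U_function
begin

text \<open>The unit ball expressed by the modular instead of the Luxemburg norm. Division by any
  number above the norm leads into it, so it never matters whether an infimum is attained.\<close>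

definition unit_hardy :: "(complex \<Rightarrow> complex) \<Rightarrow> bool" where
  "unit_hardy f \<longleftrightarrow> f holomorphic_on UHP \<and>
     (\<forall>y>0. (\<integral>\<^sup>+ x. ennreal (\<Phi> (norm (f (Complex x y)))) \<partial>lborel) \<le> 1)"

text \<open>The square around z has height Im z and every horizontal slice has modular at most 1, so
  the total is at most Im z = (Im z)^2 (1 / Im z). This is \<open>pointwise_bound\<close> with A = 1
  and v = 1 / Im z.\<close>

lemma unit_hardy_pointwise:
  assumes f: "unit_hardy f" and z: "z \<in> UHP"
  shows "norm (f z) \<le> 32 * ginv \<Phi> (1 / Im z)"
proof -
  define q where "q = Complex (Im z / 2) (Im z / 2)"
  define Q where "Q = cbox (z - q) (z + q)"
  have hol: "f holomorphic_on UHP" using f by (simp add: unit_hardy_def)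
  have y: "Im z > 0" using z by (simp add: UHP_def)
  have QU: "Q \<subseteq> UHP" using y by (auto simp: Q_def q_def in_cbox_complex_iff UHP_def)
  have [measurable]: "(\<lambda>w. ennreal (\<Phi> (norm (f w))) * indicator Q w) \<in> borel_measurable borel"
    using hol QU by (intro borel_measurable_continuous_on_ennreal continuous_on_comp continuous_intros)
      (auto simp: Q_def intro: holomorphic_on_imp_continuous_on holomorphic_on_subset)
  have "(\<integral>\<^sup>+ w. ennreal (\<Phi> (norm (f w))) * indicator Q w \<partial>lborel)
     = (\<integral>\<^sup>+ t. \<integral>\<^sup>+ x. ennreal (\<Phi> (norm (f (Complex x t)))) * indicator Q (Complex x t) \<partial>lborel \<partial>lborel)"
    by (rule nn_integral_complex) measurable
  also have "\<dots> \<le> (\<integral>\<^sup>+ t. indicator {Im z / 2..3 * Im z / 2} t \<partial>lborel)"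
  proof (rule nn_integral_mono)
    fix t
    show "(\<integral>\<^sup>+ x. ennreal (\<Phi> (norm (f (Complex x t)))) * indicator Q (Complex x t) \<partial>lborel)
      \<le> indicator {Im z / 2..3 * Im z / 2} t"
    proof (cases "t \<in> {Im z / 2..3 * Im z / 2}")
      case True
      have "(\<integral>\<^sup>+ x. ennreal (\<Phi> (norm (f (Complex x t)))) * indicator Q (Complex x t) \<partial>lborel)
         \<le> (\<integral>\<^sup>+ x. ennreal (\<Phi> (norm (f (Complex x t)))) \<partial>lborel)"
        by (intro nn_integral_mono) (auto simp: indicator_def)
      also have "\<dots> \<le> 1" using f True y by (auto simp: unit_hardy_def)
      finally show ?thesis using True by simp
    next
      case False
      hence "Complex x t \<notin> Q" for x by (auto simp: Q_def q_def in_cbox_complex_iff)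
      thus ?thesis by simp
    qed
  qed
  also have "\<dots> = ennreal (1 * (Im z)\<^sup>2 * (1 / Im z))"
    using y by (simp add: power2_eq_square field_simps)
  finally have "norm (f z) \<le> 16 * (1 + 1) * ginv \<Phi> (1 / Im z)"
    using y unfolding Q_def q_def by (intro pointwise_bound[OF hol z]) auto
  thus ?thesis by simp
qed

text \<open>A Marcinkiewicz-type argument in Orlicz form. F is the supremum of |f| over the vertical
  ray above height e, and u is |f| on the line itself. Integrating the weak-type bound against
  \<open>\<Phi> s / s\<close> and exchanging integrals leaves, for each t, the integral of
  \<Phi>(s)/s^2 over 0 < s < 12 u(t), which converges by the lower type. M depends neither on f nor
  on e.\<close>

lemma unit_hardy_maximal:
  assumes lt: "lower_type \<delta> C \<Phi>" and \<delta>: "\<delta> > 0" and C: "C \<ge> 0"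
  obtains M where "M \<ge> 0"
    "\<And>f e. unit_hardy f \<Longrightarrow> e > 0 \<Longrightarrow> \<exists>F. F \<in> borel_measurable borel \<and> (\<forall>x. F x \<ge> 0) \<and>
       (\<forall>x y. e < y \<longrightarrow> norm (f (Complex x y)) \<le> F x) \<and>
       (\<integral>\<^sup>+ x. ennreal (\<Phi> (F x)) \<partial>lborel) \<le> ennreal M"
proof -
  obtain B12 where B12: "B12 \<ge> 1" "\<And>t. 0 \<le> t \<Longrightarrow> \<Phi> (12 * t) \<le> B12 * \<Phi> t"
    using doubling[of 12] by auto
  obtain B2 where B2: "B2 \<ge> 1" "\<And>t. 0 \<le> t \<Longrightarrow> \<Phi> (2 * t) \<le> B2 * \<Phi> t"
    using doubling[of 2] by auto
  define M where "M = B2 * (5 * C / \<delta> * B12)"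
  show ?thesis
  proof (rule that)
    show "M \<ge> 0" using B2 B12 \<delta> C by (simp add: M_def)
  next
    fix f and e :: real assume f: "unit_hardy f" and e: "e > 0"
    have hol: "f holomorphic_on UHP" using f by (simp add: unit_hardy_def)
    have contf: "continuous_on UHP f" by (rule holomorphic_on_imp_continuous_on[OF hol])
    define B where "B = 32 * ginv \<Phi> (1 / e)"
    have bd: "norm (f w) \<le> B" if "e \<le> Im w" for w
    proof -
      have "norm (f w) \<le> 32 * ginv \<Phi> (1 / Im w)"
        using that e by (intro unit_hardy_pointwise f) (auto simp: UHP_def)
      also have "ginv \<Phi> (1 / Im w) \<le> ginv \<Phi> (1 / e)"
        using that e by (subst ginv_le_iff) (auto simp: ginv_nonneg field_simps)
      finally show ?thesis by (simp add: B_def)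
    qed
    define F where "F = (\<lambda>x. SUP y\<in>{e<..}. norm (f (Complex x y)))"
    have bdd: "bdd_above ((\<lambda>y. norm (f (Complex x y))) ` {e<..})" for x
      by (rule bdd_aboveI[of _ B]) (auto intro!: bd)
    have F_upper: "norm (f (Complex x y)) \<le> F x" if "e < y" for x y
      unfolding F_def using that by (intro cSUP_upper bdd) auto
    have F_nonneg: "0 \<le> F x" for x
      using F_upper[of "e + 1" x] by (meson less_add_one norm_ge_zero order.trans)
    define E where "E = (\<lambda>s. {x. s < F x})"
    have E_iff: "x \<in> E s \<longleftrightarrow> (\<exists>y>e. s < norm (f (Complex x y)))" for x s
      unfolding E_def F_def by (subst mem_Collect_eq, subst less_cSUP_iff) (auto intro: bdd)
    have line: "continuous_on UNIV (\<lambda>x. norm (f (Complex x y)))" if "y \<ge> e" for y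
      using e that by (intro continuous_intros continuous_on_compose2[OF contf])
        (auto simp: Complex_eq UHP_def intro!: continuous_intros)
    \<comment> \<open>A supremum of continuous functions is lower semicontinuous; this makes F Borel
      although the supremum is uncountable.\<close>
    have openE: "open (E s)" for s
    proof -
      have "E s = (\<Union>y\<in>{e<..}. {x. s < norm (f (Complex x y))})" by (auto simp: E_iff)
      thus ?thesis using line by (auto intro!: open_UN open_Collect_less[OF continuous_on_const])
    qed
    have [measurable]: "F \<in> borel_measurable borel"
      using openE by (subst borel_measurable_iff_greater) (auto simp: E_def)
    define u where "u = (\<lambda>t. norm (f (Complex t e)))"
    have u0: "u t \<ge> 0" for t by (simp add: u_def)
    have u_meas [measurable]: "u \<in> borel_measurable borel"
      unfolding u_def using line[of e] by (intro borel_measurable_continuous_onI) auto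
    have weak: "emeasure lborel (E s) \<le> ennreal (60 / s) * (\<integral>\<^sup>+ t. ennreal (u t) * indicator {t. s < 12 * u t} t \<partial>lborel)"
      if s: "s > 0" for s
    proof -
      \<comment> \<open>If all centred averages of u at x were at most s/6, the Poisson bound and
        the kernel estimate would give 2 pi |f| \<le> 32 s/6 < 6 s, against |f| > s. The truncation
        level is then s/12.\<close>
      have "emeasure lborel (E s) \<le> ennreal (10 / (s / 6)) * (\<integral>\<^sup>+ t. ennreal (u t) * indicator {t. s / 6 / 2 < u t} t \<partial>lborel)"
      proof (rule Hardy_Littlewood_weak_type)
        show "E s \<in> sets borel" using openE by simp
        fix x assume "x \<in> E s"
        then obtain y where y: "e < y" "s < norm (f (Complex x y))" by (auto simp: E_iff)
        show "\<exists>r>0. ennreal (2 * r * (s / 6)) < (\<integral>\<^sup>+ t. ennreal (u t) * indicator (cball x r) t \<partial>lborel)"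
        proof (rule ccontr)
          assume "\<not> ?thesis"
          hence avg: "(\<integral>\<^sup>+ t. ennreal (u t) * indicator (cball x r) t \<partial>lborel) \<le> ennreal (2 * r * (s / 6))" if "r > 0" for r
            using that by (meson not_less)
          have "ennreal (2 * pi * norm (f (Complex x y)))
             \<le> (\<integral>\<^sup>+ t. ennreal (u t) * ennreal (2 * (y - e) / ((t - x)\<^sup>2 + (y - e)\<^sup>2)) \<partial>lborel)"
            using Poisson_bound[OF hol e, of "Complex x y" B] y bd by (simp add: u_def)
          also have "\<dots> \<le> ennreal (32 * (s / 6))"
            using y s avg by (intro Poisson_kernel_le_average) auto
          finally have "2 * pi * norm (f (Complex x y)) \<le> 32 * (s / 6)" using s by simp
          moreover have "3 * s < pi * norm (f (Complex x y))"
            using y s pi_gt3 by (intro mult_strict_mono) auto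
          ultimately show False using s by simp
        qed
      qed (use s u0 u_meas in auto)
      moreover have "{t. s / 6 / 2 < u t} = {t. s < 12 * u t}" by auto
      ultimately show ?thesis by simp
    qed
    have "(\<integral>\<^sup>+ x. ennreal (\<Phi> (F x)) \<partial>lborel) \<le> (\<integral>\<^sup>+ x. ennreal B2 * ennreal (\<Phi> (F x / 2)) \<partial>lborel)"
    proof (rule nn_integral_mono)
      fix x
      show "ennreal (\<Phi> (F x)) \<le> ennreal B2 * ennreal (\<Phi> (F x / 2))"
        using B2(2)[of "F x / 2"] B2(1) F_nonneg[of x] nonneg[of "F x / 2"]
        by (simp add: ennreal_mult[symmetric] ennreal_leI)
    qed
    also have "\<dots> = ennreal B2 * (\<integral>\<^sup>+ x. ennreal (\<Phi> (F x / 2)) \<partial>lborel)"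
      using F_nonneg by (intro nn_integral_cmult measurable_compose[OF _ measurable_ennreal] borel_measurable_comp) auto
    \<comment> \<open>Layer cake over the levels s. The absolute value changes nothing for s > 0 and
      keeps the integrand measurable, since \<Phi> is uncontrolled at negative arguments.\<close>
    also have "(\<integral>\<^sup>+ x. ennreal (\<Phi> (F x / 2)) \<partial>lborel)
       \<le> (\<integral>\<^sup>+ x. \<integral>\<^sup>+ s. ennreal (\<Phi> \<bar>s\<bar> / \<bar>s\<bar>) * indicator {0<..} s * indicator (E s) x \<partial>lborel \<partial>lborel)"
    proof (rule nn_integral_mono)
      fix x
      have "ennreal (\<Phi> (F x / 2)) \<le> (\<integral>\<^sup>+ s. ennreal (\<Phi> s / s) * indicator {0<..<F x} s \<partial>lborel)"
        using F_nonneg by (rule Phi_half_le)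
      also have "\<dots> = (\<integral>\<^sup>+ s. ennreal (\<Phi> \<bar>s\<bar> / \<bar>s\<bar>) * indicator {0<..} s * indicator (E s) x \<partial>lborel)"
        by (intro nn_integral_cong) (auto simp: indicator_def E_def)
      finally show "ennreal (\<Phi> (F x / 2)) \<le> \<dots>" .
    qed
    also have "\<dots> = (\<integral>\<^sup>+ s. \<integral>\<^sup>+ x. ennreal (\<Phi> \<bar>s\<bar> / \<bar>s\<bar>) * indicator {0<..} s * indicator (E s) x \<partial>lborel \<partial>lborel)"
    proof (rule lborel_pair.Fubini')
      have [measurable]: "(\<lambda>s. \<Phi> \<bar>s\<bar>) \<in> borel_measurable borel" by (rule borel_measurable_comp) auto
      have "(\<lambda>(s, x). ennreal (\<Phi> \<bar>s\<bar> / \<bar>s\<bar>) * indicator {0<..} s * indicator {p. fst p < F (snd p)} (s, x))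
         \<in> borel_measurable (lborel \<Otimes>\<^sub>M lborel)" by measurable
      thus "(\<lambda>(s, x). ennreal (\<Phi> \<bar>s\<bar> / \<bar>s\<bar>) * indicator {0<..} s * indicator (E s) x)
         \<in> borel_measurable (lborel \<Otimes>\<^sub>M lborel)"
        by (simp add: E_def indicator_def)
    qed
    also have "\<dots> = (\<integral>\<^sup>+ s. ennreal (\<Phi> \<bar>s\<bar> / \<bar>s\<bar>) * indicator {0<..} s * emeasure lborel (E s) \<partial>lborel)"
      using openE by (simp add: nn_integral_cmult)
    also have "\<dots> \<le> (\<integral>\<^sup>+ s. \<integral>\<^sup>+ t. ennreal (\<Phi> \<bar>s\<bar> / \<bar>s\<bar>) * indicator {0<..} s * (ennreal (60 / s) *
        (ennreal (u t) * indicator {t. s < 12 * u t} t)) \<partial>lborel \<partial>lborel)"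
    proof (rule nn_integral_mono)
      fix s :: real
      show "ennreal (\<Phi> \<bar>s\<bar> / \<bar>s\<bar>) * indicator {0<..} s * emeasure lborel (E s) \<le>
        (\<integral>\<^sup>+ t. ennreal (\<Phi> \<bar>s\<bar> / \<bar>s\<bar>) * indicator {0<..} s * (ennreal (60 / s) *
        (ennreal (u t) * indicator {t. s < 12 * u t} t)) \<partial>lborel)"
        using weak[of s] by (cases "s > 0") (auto simp: nn_integral_cmult intro!: mult_left_mono)
    qed
    also have "\<dots> = (\<integral>\<^sup>+ t. \<integral>\<^sup>+ s. ennreal (\<Phi> \<bar>s\<bar> / \<bar>s\<bar>) * indicator {0<..} s * (ennreal (60 / s) *
        (ennreal (u t) * indicator {t. s < 12 * u t} t)) \<partial>lborel \<partial>lborel)"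
    proof (rule lborel_pair.Fubini')
      have [measurable]: "(\<lambda>s. \<Phi> \<bar>s\<bar>) \<in> borel_measurable borel" by (rule borel_measurable_comp) auto
      have "(\<lambda>(t, s). ennreal (\<Phi> \<bar>s\<bar> / \<bar>s\<bar>) * indicator {0<..} s * (ennreal (60 / s) *
        (ennreal (u t) * indicator {p. snd p < 12 * u (fst p)} (t, s))))
         \<in> borel_measurable (lborel \<Otimes>\<^sub>M lborel)" by measurable
      thus "(\<lambda>(t, s). ennreal (\<Phi> \<bar>s\<bar> / \<bar>s\<bar>) * indicator {0<..} s * (ennreal (60 / s) *
        (ennreal (u t) * indicator {t. s < 12 * u t} t)))
         \<in> borel_measurable (lborel \<Otimes>\<^sub>M lborel)"
        by (simp add: indicator_def)
    qed
    also have "\<dots> \<le> (\<integral>\<^sup>+ t. ennreal (5 * C / \<delta> * B12) * ennreal (\<Phi> (u t)) \<partial>lborel)"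
    proof (rule nn_integral_mono)
      fix t
      define \<tau> where "\<tau> = 12 * u t"
      show "(\<integral>\<^sup>+ s. ennreal (\<Phi> \<bar>s\<bar> / \<bar>s\<bar>) * indicator {0<..} s * (ennreal (60 / s) *
        (ennreal (u t) * indicator {t. s < 12 * u t} t)) \<partial>lborel)
        \<le> ennreal (5 * C / \<delta> * B12) * ennreal (\<Phi> (u t))"
      proof (cases "u t = 0")
        case True
        thus ?thesis by simp
      next
        case False
        hence u: "u t > 0" by (simp add: u_def)
        hence \<tau>: "\<tau> > 0" by (simp add: \<tau>_def)
        \<comment> \<open>Since 60 u(t) = 5 \<tau>, the lower type bounds the integrand by D
          s^(\<delta>-1).\<close>
        define D where "D = 5 * C * \<Phi> \<tau> * \<tau> powr - \<delta>"
        have D: "D \<ge> 0" using C nonneg[of \<tau>] \<tau> by (simp add: D_def)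
        have "(\<integral>\<^sup>+ s. ennreal (\<Phi> \<bar>s\<bar> / \<bar>s\<bar>) * indicator {0<..} s * (ennreal (60 / s) *
            (ennreal (u t) * indicator {t. s < 12 * u t} t)) \<partial>lborel)
          \<le> (\<integral>\<^sup>+ s. ennreal D * (ennreal (s powr (\<delta> - 1)) * indicator {0..\<tau>} s) \<partial>lborel)"
        proof (rule nn_integral_mono)
          fix s :: real
          show "ennreal (\<Phi> \<bar>s\<bar> / \<bar>s\<bar>) * indicator {0<..} s * (ennreal (60 / s) *
            (ennreal (u t) * indicator {t. s < 12 * u t} t))
            \<le> ennreal D * (ennreal (s powr (\<delta> - 1)) * indicator {0..\<tau>} s)"
          proof (cases "0 < s \<and> s < \<tau>")
            case True
            hence s: "0 < s" "s < \<tau>" by auto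
            have "\<Phi> s / s \<le> C * (s / \<tau>) powr \<delta> * (\<Phi> \<tau> / \<tau>)"
              using lt s by (simp add: lower_type_def)
            hence "\<Phi> s / s * (60 / s * u t) \<le> C * (s / \<tau>) powr \<delta> * (\<Phi> \<tau> / \<tau>) * (60 / s * u t)"
              using s u by (intro mult_right_mono) auto
            also have "\<dots> = D * s powr (\<delta> - 1)"
              using s \<tau> u by (simp add: D_def \<tau>_def powr_divide powr_diff powr_minus field_simps)
            finally show ?thesis
              using s u D nonneg[of s] by (simp add: \<tau>_def ennreal_mult[symmetric] ennreal_leI)
          qed (auto simp: \<tau>_def)
        qed
        also have "\<dots> = ennreal D * ennreal (\<tau> powr \<delta> / \<delta>)"
          using \<tau> \<delta> by (simp add: nn_integral_cmult nn_integral_powr)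
        also have "\<dots> = ennreal (5 * C / \<delta> * \<Phi> \<tau>)"
          using \<tau> \<delta> D by (simp add: ennreal_mult[symmetric]) (simp add: D_def powr_minus field_simps)
        also have "\<dots> \<le> ennreal (5 * C / \<delta> * (B12 * \<Phi> (u t)))"
          using B12(2)[of "u t"] u \<delta> C unfolding \<tau>_def by (intro ennreal_leI mult_left_mono) auto
        also have "\<dots> = ennreal (5 * C / \<delta> * B12) * ennreal (\<Phi> (u t))"
          using B12 C \<delta> nonneg[of "u t"] u by (simp add: ennreal_mult[symmetric])
        finally show ?thesis .
      qed
    qed
    also have "\<dots> = ennreal (5 * C / \<delta> * B12) * (\<integral>\<^sup>+ t. ennreal (\<Phi> (u t)) \<partial>lborel)"
      using u0 u_meas by (intro nn_integral_cmult measurable_compose[OF _ measurable_ennreal] borel_measurable_comp) auto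
    also have "\<dots> \<le> ennreal (5 * C / \<delta> * B12) * 1"
      using f e by (intro mult_left_mono) (auto simp: unit_hardy_def u_def)
    finally have "(\<integral>\<^sup>+ x. ennreal (\<Phi> (F x)) \<partial>lborel) \<le> ennreal B2 * (ennreal (5 * C / \<delta> * B12) * 1)"
      by (simp add: mult_left_mono)
    also have "\<dots> = ennreal M"
      using B2 B12 C \<delta> by (simp add: M_def ennreal_mult[symmetric])
    finally show "\<exists>F. F \<in> borel_measurable borel \<and> (\<forall>x. F x \<ge> 0) \<and>
       (\<forall>x y. e < y \<longrightarrow> norm (f (Complex x y)) \<le> F x) \<and>
       (\<integral>\<^sup>+ x. ennreal (\<Phi> (F x)) \<partial>lborel) \<le> ennreal M"
      using F_upper F_nonneg by (intro exI[of _ F]) auto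
  qed
qed

end

section \<open>A Carleson embedding\<close>

locale U_pair = A: U_function \<Phi>1 + B: U_function \<Phi>2 for \<Phi>1 \<Phi>2
begin

text \<open>The critical density: a box of side y may carry mass of order 1 /
  \<Phi>2(\<Phi>1^{-1}(1/y)), and y^2 is its area. It depends neither on \<alpha> nor on g, so a
  single embedding serves (i) and (iii).\<close>

definition kap :: "real \<Rightarrow> real" where
  "kap y = 1 / (y\<^sup>2 * \<Phi>2 (ginv \<Phi>1 (1 / y)))"

lemma kap_nonneg: "0 < y \<Longrightarrow> 0 \<le> kap y"
  by (simp add: kap_def B.nonneg A.ginv_nonneg)

text \<open>\<open>ginv \<Phi>1\<close> is monotone on the half-line and so Borel; the clamp
  \<open>max 0\<close> is there because its values at negative arguments are unspecified.\<close>

lemma kap_measurable [measurable]: "(\<lambda>y. ennreal (kap y) * indicator {0<..} y) \<in> borel_measurable borel"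
proof -
  define b where "b = (\<lambda>y. ginv \<Phi>1 (max 0 y))"
  have "mono b" unfolding b_def
    by (intro monoI) (auto simp: A.ginv_le_iff A.ginv_nonneg)
  hence [measurable]: "b \<in> borel_measurable borel" by (rule borel_measurable_mono)
  have [measurable]: "(\<lambda>y. \<Phi>2 (b (1 / y))) \<in> borel_measurable borel"
  proof (rule B.borel_measurable_comp)
    show "(\<lambda>y. b (1 / y)) \<in> borel_measurable borel" by measurable
  qed (simp add: b_def A.ginv_nonneg)
  have "(\<lambda>y. ennreal (1 / (y\<^sup>2 * \<Phi>2 (b (1 / y)))) * indicator {0<..} y) \<in> borel_measurable borel"
    by measurable
  also have "(\<lambda>y. ennreal (1 / (y\<^sup>2 * \<Phi>2 (b (1 / y)))) * indicator {0<..} y) = (\<lambda>y. ennreal (kap y) * indicator {0<..} y)"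
    by (rule ext) (auto simp: kap_def b_def indicator_def)
  finally show ?thesis .
qed

text \<open>Fubini reduces the embedding to vertical half-lines, where f is controlled
  both by its maximal function and by the pointwise estimate.\<close>

lemma vertical_estimate:
  assumes lt: "lower_type \<delta> C (\<Phi>2 \<circ> ginv \<Phi>1)" and \<delta>: "\<delta> > 0" and C: "C \<ge> 0"
  obtains M where "M \<ge> 0"
    "\<And>w l. 0 \<le> l \<Longrightarrow> (\<And>y. 0 < y \<Longrightarrow> 0 \<le> w y \<and> w y \<le> l \<and> w y \<le> 32 * ginv \<Phi>1 (1 / y)) \<Longrightarrow>
       (\<integral>\<^sup>+ y. ennreal (kap y * \<Phi>2 (w y)) * indicator {0<..} y \<partial>lborel) \<le> ennreal M * ennreal (\<Phi>1 l)"
proof -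
  obtain B where B: "B \<ge> 1" "\<And>t. 0 \<le> t \<Longrightarrow> \<Phi>2 (32 * t) \<le> B * \<Phi>2 t"
    using B.doubling[of 32] by auto
  show ?thesis
  proof (rule that)
    show "C / \<delta> + B \<ge> 0" using C \<delta> B by simp
    fix w :: "real \<Rightarrow> real" and l :: real
    assume l: "0 \<le> l" and w: "\<And>y. 0 < y \<Longrightarrow> 0 \<le> w y \<and> w y \<le> l \<and> w y \<le> 32 * ginv \<Phi>1 (1 / y)"
    show "(\<integral>\<^sup>+ y. ennreal (kap y * \<Phi>2 (w y)) * indicator {0<..} y \<partial>lborel) \<le> ennreal (C / \<delta> + B) * ennreal (\<Phi>1 l)"
    proof (cases "l = 0")
      case True
      hence "ennreal (kap y * \<Phi>2 (w y)) * indicator {0<..} y = 0" for y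
        using w[of y] by (cases "y > 0") auto
      hence "(\<integral>\<^sup>+ y. ennreal (kap y * \<Phi>2 (w y)) * indicator {0<..} y \<partial>lborel) = (\<integral>\<^sup>+ y. 0 \<partial>(lborel :: real measure))"
        by (intro nn_integral_cong)
      thus ?thesis by simp
    next
      case False
      \<comment> \<open>The half-line is cut at y = 1/\<sigma>, where \<Phi>1^{-1}(1/y) equals l.
        Below the cut, w \<le> l and the lower type give a multiple of y^(\<delta>-1); above it the
        bound 32 \<Phi>1^{-1}(1/y) gives a multiple of y^(-2). Both integrate to multiples of
        \<sigma>.\<close>
      define \<sigma> where "\<sigma> = \<Phi>1 l"
      have \<sigma>: "\<sigma> > 0" and l\<sigma>: "ginv \<Phi>1 \<sigma> = l" using l False A.pos[of l] by (simp_all add: \<sigma>_def)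
      define D where "D = C * \<sigma> * \<sigma> powr \<delta>"
      have D: "D \<ge> 0" using C \<sigma> by (simp add: D_def)
      have "(\<integral>\<^sup>+ y. ennreal (kap y * \<Phi>2 (w y)) * indicator {0<..} y \<partial>lborel)
        \<le> (\<integral>\<^sup>+ y. ennreal D * (ennreal (y powr (\<delta> - 1)) * indicator {0..1 / \<sigma>} y)
             + ennreal B * (ennreal (y powr - 2) * indicator {1 / \<sigma>..} y) \<partial>lborel)"
      proof (rule nn_integral_mono)
        fix y :: real
        show "ennreal (kap y * \<Phi>2 (w y)) * indicator {0<..} y
          \<le> ennreal D * (ennreal (y powr (\<delta> - 1)) * indicator {0..1 / \<sigma>} y)
             + ennreal B * (ennreal (y powr - 2) * indicator {1 / \<sigma>..} y)"
        proof (cases "y > 0")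
          case True
          define P where "P = \<Phi>2 (ginv \<Phi>1 (1 / y))"
          have P: "P > 0" using True by (simp add: P_def B.pos A.ginv_pos)
          note wy = w[OF True]
          show ?thesis
          proof (cases "y \<le> 1 / \<sigma>")
            case le: True
            have "\<sigma> \<le> 1 / y" using le True \<sigma> by (simp add: field_simps)
            hence "(\<Phi>2 \<circ> ginv \<Phi>1) \<sigma> / \<sigma>
                \<le> C * (\<sigma> / (1 / y)) powr \<delta> * ((\<Phi>2 \<circ> ginv \<Phi>1) (1 / y) / (1 / y))"
              using lt \<sigma> unfolding lower_type_def by blast
            hence "\<Phi>2 l / \<sigma> \<le> C * (\<sigma> * y) powr \<delta> * (P * y)"
              by (simp add: P_def l\<sigma>)
            hence "\<Phi>2 l \<le> C * (\<sigma> * y) powr \<delta> * (P * y) * \<sigma>"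
              using \<sigma> by (simp add: field_simps)
            hence "kap y * \<Phi>2 l \<le> kap y * (C * (\<sigma> * y) powr \<delta> * (P * y) * \<sigma>)"
              using kap_nonneg[OF True] by (rule mult_left_mono)
            also have "\<dots> = D * y powr (\<delta> - 1)"
              using True P \<sigma> by (simp add: kap_def P_def[symmetric] D_def powr_mult powr_diff power2_eq_square)
            finally have "kap y * \<Phi>2 (w y) \<le> D * y powr (\<delta> - 1)"
              using mult_left_mono[OF B.mono[of "w y" l] kap_nonneg[OF True]] wy by linarith
            hence "ennreal (kap y * \<Phi>2 (w y)) \<le> ennreal D * ennreal (y powr (\<delta> - 1))"
              using D by (simp add: ennreal_mult[symmetric] ennreal_leI)
            thus ?thesis using True le by (auto simp: indicator_def intro: add_increasing2)
          next
            case False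
            have "\<Phi>2 (w y) \<le> \<Phi>2 (32 * ginv \<Phi>1 (1 / y))" using wy by (intro B.mono) auto
            also have "\<dots> \<le> B * P" unfolding P_def using True by (intro B) (simp add: A.ginv_nonneg)
            finally have "kap y * \<Phi>2 (w y) \<le> kap y * (B * P)"
              using kap_nonneg[OF True] by (intro mult_left_mono)
            also have "\<dots> = B * y powr - 2"
            proof -
              have "kap y = 1 / (y\<^sup>2 * P)" by (simp add: kap_def P_def)
              thus ?thesis using True P by (simp add: powr_minus powr_numeral field_simps)
            qed
            finally have "ennreal (kap y * \<Phi>2 (w y)) \<le> ennreal B * ennreal (y powr - 2)"
              using B by (simp add: ennreal_mult[symmetric] ennreal_leI)
            thus ?thesis using True False by (auto simp: indicator_def)
          qed
        qed auto
      qed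
      also have "\<dots> = ennreal D * ennreal ((1 / \<sigma>) powr \<delta> / \<delta>) + ennreal B * ennreal (1 / (1 / \<sigma>))"
        using \<sigma> \<delta> by (subst nn_integral_add)
          (auto simp: nn_integral_cmult nn_integral_powr nn_integral_inverse_square)
      also have "\<dots> = ennreal (D * ((1 / \<sigma>) powr \<delta> / \<delta>) + B * \<sigma>)"
        using D \<sigma> \<delta> B by (simp add: ennreal_mult[symmetric] ennreal_plus[symmetric] del: ennreal_plus)
      also have "D * ((1 / \<sigma>) powr \<delta> / \<delta>) + B * \<sigma> = (C / \<delta> + B) * \<sigma>"
        using \<sigma> \<delta> by (simp add: D_def powr_divide field_simps)
      also have "ennreal \<dots> = ennreal (C / \<delta> + B) * ennreal (\<Phi>1 l)"
        using C \<delta> B \<sigma> unfolding \<sigma>_def by (intro ennreal_mult) auto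
      finally show ?thesis .
    qed
  qed
qed

text \<open>The maximal function is available only above a line Im w = e, so f is replaced by f(z +
  \<i> e) while \<open>kap\<close> stays in place. Moving up only improves the pointwise bound,
  since \<open>ginv \<Phi>1\<close> is nondecreasing. M1 and M2 do not depend on e, and Fatou's
  lemma removes the translation.\<close>

lemma Carleson_embedding:
  assumes lt1: "lower_type \<delta>1 C1 \<Phi>1" "\<delta>1 > 0" "C1 \<ge> 0"
    and lt3: "lower_type \<delta>3 C3 (\<Phi>2 \<circ> ginv \<Phi>1)" "\<delta>3 > 0" "C3 \<ge> 0"
  obtains M where "M \<ge> 0"
    "\<And>f. A.unit_hardy f \<Longrightarrow>
      (\<integral>\<^sup>+ z. indicator UHP z * ennreal (kap (Im z) * \<Phi>2 (norm (f z))) \<partial>lborel) \<le> ennreal M"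
proof -
  obtain M1 where M1: "M1 \<ge> 0" "\<And>w l. 0 \<le> l \<Longrightarrow> (\<And>y. 0 < y \<Longrightarrow> 0 \<le> w y \<and> w y \<le> l \<and> w y \<le> 32 * ginv \<Phi>1 (1 / y)) \<Longrightarrow>
       (\<integral>\<^sup>+ y. ennreal (kap y * \<Phi>2 (w y)) * indicator {0<..} y \<partial>lborel) \<le> ennreal M1 * ennreal (\<Phi>1 l)"
    using vertical_estimate[OF lt3] by blast
  obtain M2 where M2: "M2 \<ge> 0"
    "\<And>f e. A.unit_hardy f \<Longrightarrow> e > 0 \<Longrightarrow> \<exists>F. F \<in> borel_measurable borel \<and> (\<forall>x. F x \<ge> 0) \<and>
       (\<forall>x y. e < y \<longrightarrow> norm (f (Complex x y)) \<le> F x) \<and>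
       (\<integral>\<^sup>+ x. ennreal (\<Phi>1 (F x)) \<partial>lborel) \<le> ennreal M2"
    using A.unit_hardy_maximal[OF lt1] by blast
  show ?thesis
  proof (rule that)
    show "M1 * M2 \<ge> 0" using M1 M2 by simp
    fix f assume f: "A.unit_hardy f"
    hence hol: "f holomorphic_on UHP" by (simp add: A.unit_hardy_def)
    have contf: "continuous_on UHP f" by (rule holomorphic_on_imp_continuous_on[OF hol])
    define G where "G = (\<lambda>e z. indicator UHP z * ennreal (kap (Im z) * \<Phi>2 (norm (f (z + \<i> * of_real e)))))"
    have G_meas [measurable]: "G e \<in> borel_measurable borel" if "e \<ge> 0" for e
    proof -
      have 1: "(\<lambda>z. ennreal (\<Phi>2 (norm (f (z + \<i> * of_real e)))) * indicator UHP z) \<in> borel_measurable borel"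
        using that
        by (intro borel_measurable_continuous_on_ennreal B.continuous_on_comp continuous_intros
            continuous_on_compose2[OF contf]) (auto simp: UHP_def intro!: open_UHP[unfolded UHP_def] borel_open)
      have 2: "(\<lambda>z. ennreal (kap (Im z)) * indicator {0<..} (Im z)) \<in> borel_measurable borel"
        by (rule measurable_compose[OF _ kap_measurable]) (intro borel_measurable_continuous_onI continuous_intros)
      have "(\<lambda>z. (ennreal (kap (Im z)) * indicator {0<..} (Im z)) *
          (ennreal (\<Phi>2 (norm (f (z + \<i> * of_real e)))) * indicator UHP z)) \<in> borel_measurable borel"
        by (rule borel_measurable_times_ennreal[OF 2 1])
      also have "(\<lambda>z. (ennreal (kap (Im z)) * indicator {0<..} (Im z)) *
          (ennreal (\<Phi>2 (norm (f (z + \<i> * of_real e)))) * indicator UHP z)) = G e"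
        by (rule ext) (auto simp: G_def indicator_def UHP_def ennreal_mult kap_nonneg B.nonneg)
      finally show ?thesis .
    qed
    have bound: "(\<integral>\<^sup>+ z. G e z \<partial>lborel) \<le> ennreal (M1 * M2)" if e: "e > 0" for e
    proof -
      obtain F where F [measurable]: "F \<in> borel_measurable borel" and F0: "\<And>x. F x \<ge> 0"
        and Fu: "\<And>x y. e < y \<Longrightarrow> norm (f (Complex x y)) \<le> F x"
        and FM: "(\<integral>\<^sup>+ x. ennreal (\<Phi>1 (F x)) \<partial>lborel) \<le> ennreal M2"
        using M2(2)[OF f e] by blast
      have [measurable]: "G e \<in> borel_measurable borel" using e by (intro G_meas) auto
      have "(\<integral>\<^sup>+ z. G e z \<partial>lborel) = (\<integral>\<^sup>+ y. \<integral>\<^sup>+ x. G e (Complex x y) \<partial>lborel \<partial>lborel)"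
        by (rule nn_integral_complex) measurable
      \<comment> \<open>The vertical variable goes inside, so that the vertical estimate applies on
        each line with l = F(x).\<close>
      also have "\<dots> = (\<integral>\<^sup>+ x. \<integral>\<^sup>+ y. G e (Complex x y) \<partial>lborel \<partial>lborel)"
        by (rule lborel_pair.Fubini') measurable
      also have "\<dots> \<le> (\<integral>\<^sup>+ x. ennreal M1 * ennreal (\<Phi>1 (F x)) \<partial>lborel)"
      proof (rule nn_integral_mono)
        fix x
        define w where "w = (\<lambda>y. norm (f (Complex x (y + e))))"
        have sh: "Complex x y + \<i> * of_real e = Complex x (y + e)" for y
          by (simp add: complex_eq_iff)
        have "(\<integral>\<^sup>+ y. G e (Complex x y) \<partial>lborel) = (\<integral>\<^sup>+ y. ennreal (kap y * \<Phi>2 (w y)) * indicator {0<..} y \<partial>lborel)"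
          by (intro nn_integral_cong) (auto simp: G_def UHP_def w_def sh indicator_def)
        also have "\<dots> \<le> ennreal M1 * ennreal (\<Phi>1 (F x))"
        proof (rule M1(2)[OF F0])
          fix y :: real assume y: "0 < y"
          have "w y \<le> 32 * ginv \<Phi>1 (1 / (y + e))"
            using A.unit_hardy_pointwise[OF f, of "Complex x (y + e)"] y e by (simp add: w_def UHP_def)
          also have "ginv \<Phi>1 (1 / (y + e)) \<le> ginv \<Phi>1 (1 / y)"
            using y e by (subst A.ginv_le_iff) (auto simp: A.ginv_nonneg field_simps)
          finally show "0 \<le> w y \<and> w y \<le> F x \<and> w y \<le> 32 * ginv \<Phi>1 (1 / y)"
            using Fu[of "y + e" x] y by (simp add: w_def)
        qed
        finally show "(\<integral>\<^sup>+ y. G e (Complex x y) \<partial>lborel) \<le> ennreal M1 * ennreal (\<Phi>1 (F x))" .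
      qed
      also have "\<dots> = ennreal M1 * (\<integral>\<^sup>+ x. ennreal (\<Phi>1 (F x)) \<partial>lborel)"
        using F0 by (intro nn_integral_cmult measurable_compose[OF _ measurable_ennreal] A.borel_measurable_comp) auto
      also have "\<dots> \<le> ennreal M1 * ennreal M2" using FM by (intro mult_left_mono) auto
      also have "\<dots> = ennreal (M1 * M2)" using M1 M2 by (simp add: ennreal_mult)
      finally show ?thesis .
    qed
    define \<epsilon> where "\<epsilon> = (\<lambda>n. 1 / real (Suc n))"
    have \<epsilon>: "\<epsilon> n > 0" for n by (simp add: \<epsilon>_def)
    have lim: "(\<lambda>n. G (\<epsilon> n) z) \<longlonglongrightarrow> G 0 z" for z
    proof (cases "z \<in> UHP")
      case True
      have "(\<lambda>n. \<Phi>2 (norm (f (z + \<i> * of_real (\<epsilon> n))))) \<longlonglongrightarrow> \<Phi>2 (norm (f z))"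
      proof (rule continuous_on_tendsto_compose[where f = "\<lambda>w. \<Phi>2 (norm (f w))" and s = UHP])
        show "continuous_on UHP (\<lambda>w. \<Phi>2 (norm (f w)))"
          by (intro B.continuous_on_comp continuous_intros contf) auto
        have "(\<lambda>n. z + \<i> * of_real (\<epsilon> n)) \<longlonglongrightarrow> z + \<i> * of_real 0"
          unfolding \<epsilon>_def by (intro tendsto_intros lim_1_over_n[THEN LIMSEQ_Suc]) 
        thus "(\<lambda>n. z + \<i> * of_real (\<epsilon> n)) \<longlonglongrightarrow> z" by simp
        show "\<forall>\<^sub>F n in sequentially. z + \<i> * of_real (\<epsilon> n) \<in> UHP"
          using True \<epsilon> by (auto simp: UHP_def add_pos_pos)
      qed fact
      thus ?thesis using True unfolding G_def by (simp add: tendsto_ennrealI tendsto_mult_left)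
    qed (simp add: G_def)
    have "(\<integral>\<^sup>+ z. G 0 z \<partial>lborel) = (\<integral>\<^sup>+ z. liminf (\<lambda>n. G (\<epsilon> n) z) \<partial>lborel)"
      using lim by (intro nn_integral_cong lim_imp_Liminf[symmetric]) auto
    also have "\<dots> \<le> liminf (\<lambda>n. \<integral>\<^sup>+ z. G (\<epsilon> n) z \<partial>lborel)"
      using \<epsilon> by (intro nn_integral_liminf) (auto intro!: G_meas less_imp_le)
    also have "\<dots> \<le> liminf (\<lambda>n::nat. ennreal (M1 * M2))"
      using \<epsilon> bound by (intro Liminf_mono) auto
    also have "\<dots> = ennreal (M1 * M2)" by (simp add: Liminf_const)
    finally show "(\<integral>\<^sup>+ z. indicator UHP z * ennreal (kap (Im z) * \<Phi>2 (norm (f z))) \<partial>lborel) \<le> ennreal (M1 * M2)"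
      by (simp add: G_def)
  qed
qed

end

section \<open>Multipliers\<close>

text \<open>The strict inequality yields an admissible r' < r on each horizontal line; monotonicity
  of \<Phi> then passes to the common r.\<close>

lemma (in U_function) unit_hardy_scaled:
  assumes f: "f \<in> hardy_orlicz \<Phi>" and r: "lux_H \<Phi> f < ennreal r" "r > 0"
  shows "unit_hardy (\<lambda>z. f z / of_real r)"
  unfolding unit_hardy_def
proof (intro conjI allI impI)
  show "(\<lambda>z. f z / of_real r) holomorphic_on UHP"
    using f r by (intro holomorphic_intros) (auto simp: hardy_orlicz_def)
  fix y :: real assume y: "y > 0"
  have "(INF r\<in>{r::real. r > 0 \<and> (\<integral>\<^sup>+ x. ennreal (\<Phi> (cmod (f (Complex x y)) / r)) \<partial>lborel) \<le> 1}. ennreal r)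
     \<le> lux_H \<Phi> f"
    unfolding lux_H_def by (rule SUP_upper) (use y in simp)
  also note r(1)
  finally obtain r' where r': "r' > 0" "(\<integral>\<^sup>+ x. ennreal (\<Phi> (cmod (f (Complex x y)) / r')) \<partial>lborel) \<le> 1"
      "ennreal r' < ennreal r"
    by (auto simp: INF_less_iff)
  have "r' \<le> r" using r' r by (simp add: ennreal_less_iff)
  have "(\<integral>\<^sup>+ x. ennreal (\<Phi> (norm (f (Complex x y) / of_real r))) \<partial>lborel)
      \<le> (\<integral>\<^sup>+ x. ennreal (\<Phi> (cmod (f (Complex x y)) / r')) \<partial>lborel)"
  proof (intro nn_integral_mono ennreal_leI)
    fix x
    have "norm (f (Complex x y)) / r \<le> norm (f (Complex x y)) / r'"
      using r' r \<open>r' \<le> r\<close> by (intro divide_left_mono) auto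
    thus "\<Phi> (norm (f (Complex x y) / of_real r)) \<le> \<Phi> (cmod (f (Complex x y)) / r')"
      using r by (intro mono) (auto simp: norm_divide)
  qed
  also note r'(2)
  finally show "(\<integral>\<^sup>+ x. ennreal (\<Phi> (norm (f (Complex x y) / of_real r))) \<partial>lborel) \<le> 1" .
qed

text \<open>On the square around z the weight is at least c (Im z)^\<alpha>. So the unweighted
  modular is at most (Im z)^(-\<alpha>) / c = (1/c) (Im z)^2 v with v = (Im z)^(-2-\<alpha>), which
  is \<open>pointwise_bound\<close> with A = 1/c.\<close>

lemma (in U_function) bergman_pointwise:
  obtains K where "K \<ge> 0"
    "\<And>h z. h holomorphic_on UHP \<Longrightarrow> Vint \<alpha> (\<lambda>w. \<Phi> (cmod (h w))) \<le> 1 \<Longrightarrow> z \<in> UHP \<Longrightarrow>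
       norm (h z) \<le> K * ginv \<Phi> (1 / Im z powr (2 + \<alpha>))"
proof -
  \<comment> \<open>The minimum of s^\<alpha> over [1/2, 3/2] lies at the left end for \<alpha>
    \<ge> 0 and at the right end otherwise.\<close>
  define c where "c = min ((1 / 2) powr \<alpha>) ((3 / 2 :: real) powr \<alpha>)"
  have c: "c > 0" by (simp add: c_def)
  have c_le: "c \<le> s powr \<alpha>" if "1 / 2 \<le> s" "s \<le> 3 / 2" for s
  proof (cases "\<alpha> \<ge> 0")
    case True
    hence "(1 / 2) powr \<alpha> \<le> s powr \<alpha>" using that by (intro powr_mono2) auto
    thus ?thesis by (simp add: c_def)
  next
    case False
    hence "(3 / 2) powr \<alpha> \<le> s powr \<alpha>" using that by (intro powr_mono2') auto
    thus ?thesis by (simp add: c_def)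
  qed
  show ?thesis
  proof (rule that)
    show "16 * (1 + 1 / c) \<ge> 0" using c by simp
    fix h z assume hol: "h holomorphic_on UHP" and V: "Vint \<alpha> (\<lambda>w. \<Phi> (cmod (h w))) \<le> 1" and z: "z \<in> UHP"
    have y: "Im z > 0" using z by (simp add: UHP_def)
    define q where "q = Complex (Im z / 2) (Im z / 2)"
    define Q where "Q = cbox (z - q) (z + q)"
    have Q: "0 < Im w \<and> Im z / 2 \<le> Im w \<and> Im w \<le> 3 / 2 * Im z" if "w \<in> Q" for w
      using that y by (auto simp: Q_def q_def in_cbox_complex_iff)
    have "continuous_on UHP (\<lambda>w. Im w powr \<alpha> * \<Phi> (cmod (h w)))"
      by (intro continuous_intros continuous_on_comp holomorphic_on_imp_continuous_on[OF hol]) (auto simp: UHP_def)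
    hence "(\<lambda>w. ennreal (Im w powr \<alpha> * \<Phi> (cmod (h w))) * indicator UHP w) \<in> borel_measurable borel"
      by (intro borel_measurable_continuous_on_ennreal) (simp_all add: open_UHP)
    hence [measurable]: "(\<lambda>w. indicator UHP w * ennreal (Im w powr \<alpha> * \<Phi> (cmod (h w)))) \<in> borel_measurable borel"
      by (simp add: mult.commute)
    have "(\<integral>\<^sup>+ w. ennreal (\<Phi> (norm (h w))) * indicator Q w \<partial>lborel)
      \<le> (\<integral>\<^sup>+ w. ennreal (1 / (c * Im z powr \<alpha>)) * (indicator UHP w * ennreal (Im w powr \<alpha> * \<Phi> (cmod (h w)))) \<partial>lborel)"
    proof (rule nn_integral_mono)
      fix w
      show "ennreal (\<Phi> (norm (h w))) * indicator Q w
        \<le> ennreal (1 / (c * Im z powr \<alpha>)) * (indicator UHP w * ennreal (Im w powr \<alpha> * \<Phi> (cmod (h w))))"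
      proof (cases "w \<in> Q")
        case True
        note w = Q[OF True]
        have "c \<le> (Im w / Im z) powr \<alpha>" using w y by (intro c_le) (auto simp: field_simps)
        hence "c * Im z powr \<alpha> \<le> Im w powr \<alpha>" using w y by (simp add: powr_divide field_simps)
        hence "c * Im z powr \<alpha> * \<Phi> (norm (h w)) \<le> Im w powr \<alpha> * \<Phi> (norm (h w))"
          by (intro mult_right_mono nonneg) auto
        hence "\<Phi> (norm (h w)) \<le> 1 / (c * Im z powr \<alpha>) * (Im w powr \<alpha> * \<Phi> (norm (h w)))"
          using c y by (simp add: field_simps)
        thus ?thesis
          using True w c nonneg[of "norm (h w)"] by (simp add: UHP_def ennreal_mult[symmetric] ennreal_leI)
      qed auto
    qed
    also have "\<dots> = ennreal (1 / (c * Im z powr \<alpha>)) * Vint \<alpha> (\<lambda>w. \<Phi> (cmod (h w)))"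
      unfolding Vint_def by (rule nn_integral_cmult) measurable
    also have "\<dots> \<le> ennreal (1 / (c * Im z powr \<alpha>)) * 1"
      using V by (intro mult_left_mono) auto
    also have "\<dots> = ennreal (1 / c * (Im z)\<^sup>2 * (1 / Im z powr (2 + \<alpha>)))"
      using y by (simp add: powr_add powr_numeral)
    finally show "norm (h z) \<le> 16 * (1 + 1 / c) * ginv \<Phi> (1 / Im z powr (2 + \<alpha>))"
      using y c unfolding Q_def q_def by (intro pointwise_bound[OF hol z]) auto
  qed
qed

section \<open>Sufficient and necessary conditions for multipliers\<close>

context U_pair
begin

lemma omega_pos: "y > 0 \<Longrightarrow> 0 < omega_weight \<Phi>1 \<Phi>2 \<alpha> y"
  by (simp add: omega_weight_def A.ginv_pos B.ginv_pos)

text \<open>The hypothesis \<open>weight\<close> isolates the only way in which g and \<alpha>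
  enter. With the Carleson embedding it bounds the modular of F g by D M for F in the unit ball;
  division by C \<ge> D M brings it below 1 by \<open>scale_le\<close>.\<close>

lemma multiplierI:
  assumes lt1: "lower_type \<delta>1 C1 \<Phi>1" "\<delta>1 > 0" "C1 \<ge> 0"
    and lt3: "lower_type \<delta>3 C3 (\<Phi>2 \<circ> ginv \<Phi>1)" "\<delta>3 > 0" "C3 \<ge> 0"
    and g: "g holomorphic_on UHP" and D: "D \<ge> 0"
    and weight: "\<And>z t. z \<in> UHP \<Longrightarrow> t \<ge> 0 \<Longrightarrow> Im z powr \<alpha> * \<Phi>2 (norm (g z) * t) \<le> D * (kap (Im z) * \<Phi>2 t)"
  shows "g \<in> multipliers_HA \<Phi>1 \<Phi>2 \<alpha>"
proof -
  obtain M where M: "M \<ge> 0" "\<And>f. A.unit_hardy f \<Longrightarrow>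
      (\<integral>\<^sup>+ z. indicator UHP z * ennreal (kap (Im z) * \<Phi>2 (norm (f z))) \<partial>lborel) \<le> ennreal M"
    using Carleson_embedding[OF lt1 lt3] by blast
  define C where "C = max 1 (D * M)"
  have C: "C \<ge> 1" "D * M \<le> C" by (auto simp: C_def)
  have scaled: "lux_A \<Phi>2 \<alpha> (\<lambda>z. f z * g z) \<le> ennreal (C * r)"
    if f: "f \<in> hardy_orlicz \<Phi>1" and r: "lux_H \<Phi>1 f < ennreal r" "r > 0" for f r
  proof -
    define F where "F = (\<lambda>z. f z / of_real r)"
    have F: "A.unit_hardy F" unfolding F_def using f r by (rule A.unit_hardy_scaled)
    hence holF: "F holomorphic_on UHP" by (simp add: A.unit_hardy_def)
    have "Vint \<alpha> (\<lambda>z. \<Phi>2 (cmod (f z * g z) / (C * r)))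
      \<le> (\<integral>\<^sup>+ z. ennreal (D / C) * (indicator UHP z * ennreal (kap (Im z) * \<Phi>2 (norm (F z)))) \<partial>lborel)"
      unfolding Vint_def
    proof (rule nn_integral_mono)
      fix z
      show "indicator UHP z * ennreal (Im z powr \<alpha> * \<Phi>2 (cmod (f z * g z) / (C * r)))
        \<le> ennreal (D / C) * (indicator UHP z * ennreal (kap (Im z) * \<Phi>2 (norm (F z))))"
      proof (cases "z \<in> UHP")
        case True
        have "cmod (f z * g z) / (C * r) = (1 / C) * (norm (g z) * norm (F z))"
          using r C by (simp add: F_def norm_mult norm_divide)
        also have "\<Phi>2 \<dots> \<le> 1 / C * \<Phi>2 (norm (g z) * norm (F z))"
          using C by (intro B.scale_le) auto
        finally have "Im z powr \<alpha> * \<Phi>2 (cmod (f z * g z) / (C * r))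
          \<le> Im z powr \<alpha> * (1 / C * \<Phi>2 (norm (g z) * norm (F z)))"
          by (intro mult_left_mono) auto
        also have "\<dots> = 1 / C * (Im z powr \<alpha> * \<Phi>2 (norm (g z) * norm (F z)))" by simp
        also have "\<dots> \<le> 1 / C * (D * (kap (Im z) * \<Phi>2 (norm (F z))))"
          using C True by (intro mult_left_mono weight) auto
        also have "\<dots> = D / C * (kap (Im z) * \<Phi>2 (norm (F z)))" by simp
        finally show ?thesis using True D C
          by (auto simp: UHP_def ennreal_mult'[symmetric] intro!: ennreal_leI)
      qed auto
    qed
    also have "\<dots> = ennreal (D / C) * (\<integral>\<^sup>+ z. indicator UHP z * ennreal (kap (Im z) * \<Phi>2 (norm (F z))) \<partial>lborel)"
    proof (rule nn_integral_cmult)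
      have "(\<lambda>z. ennreal (\<Phi>2 (norm (F z))) * indicator UHP z) \<in> borel_measurable borel"
        by (intro borel_measurable_continuous_on_ennreal B.continuous_on_comp continuous_intros
            holomorphic_on_imp_continuous_on[OF holF]) (auto simp: open_UHP)
      moreover have "(\<lambda>z. ennreal (kap (Im z)) * indicator {0<..} (Im z)) \<in> borel_measurable borel"
        by (rule measurable_compose[OF _ kap_measurable]) (intro borel_measurable_continuous_onI continuous_intros)
      ultimately have "(\<lambda>z. (ennreal (kap (Im z)) * indicator {0<..} (Im z)) * (ennreal (\<Phi>2 (norm (F z))) * indicator UHP z))
          \<in> borel_measurable borel"
        by (rule borel_measurable_times_ennreal[rotated])
      also have "(\<lambda>z. (ennreal (kap (Im z)) * indicator {0<..} (Im z)) * (ennreal (\<Phi>2 (norm (F z))) * indicator UHP z))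
        = (\<lambda>z. indicator UHP z * ennreal (kap (Im z) * \<Phi>2 (norm (F z))))"
        by (rule ext) (auto simp: indicator_def UHP_def ennreal_mult kap_nonneg B.nonneg)
      finally show "(\<lambda>z. indicator UHP z * ennreal (kap (Im z) * \<Phi>2 (norm (F z)))) \<in> borel_measurable lborel"
        by simp
    qed
    also have "\<dots> \<le> ennreal (D / C) * ennreal M" using M(2)[OF F] by (intro mult_left_mono) auto
    also have "\<dots> = ennreal (D * M / C)" using D M C by (simp add: ennreal_mult[symmetric])
    also have "\<dots> \<le> 1" using C by (simp add: ennreal_le_1)
    finally show ?thesis
      unfolding lux_A_def by (intro INF_lower) (use C r in auto)
  qed
  have "lux_A \<Phi>2 \<alpha> (\<lambda>z. f z * g z) \<le> ennreal C * lux_H \<Phi>1 f" if f: "f \<in> hardy_orlicz \<Phi>1" for f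
  proof -
    have "lux_H \<Phi>1 f < \<infinity>" using f by (simp add: hardy_orlicz_def)
    then obtain l where l: "l \<ge> 0" "lux_H \<Phi>1 f = ennreal l" by (cases "lux_H \<Phi>1 f") auto
    show ?thesis
    \<comment> \<open>\<open>scaled\<close> needs r strictly above the norm of f; the excess e / C
      costs exactly e.\<close>
    proof (rule ennreal_le_epsilon)
      fix e :: real assume e: "e > 0"
      have "lux_A \<Phi>2 \<alpha> (\<lambda>z. f z * g z) \<le> ennreal (C * (l + e / C))"
        using l e C by (intro scaled f) (auto simp: ennreal_less_iff add_nonneg_pos)
      also have "C * (l + e / C) = C * l + e" using C by (simp add: field_simps)
      also have "ennreal (C * l + e) = ennreal C * lux_H \<Phi>1 f + ennreal e"
        using l e C by (simp add: ennreal_mult)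
      finally show "lux_A \<Phi>2 \<alpha> (\<lambda>z. f z * g z) \<le> ennreal C * lux_H \<Phi>1 f + ennreal e" .
    qed
  qed
  thus ?thesis using g C unfolding multipliers_HA_def
    by (auto intro!: exI[of _ C])
qed

text \<open>The square gives decay like |x|^(-2), integrable even for \<Phi>1 of linear growth. By
  \<open>scale_le\<close>, \<Phi>1(|f|/64) is at most k/64 times \<Phi>1(b) = 1/y, which is 1/32 of
  the Poisson kernel of width y. That kernel has integral at most 32, hence 64.\<close>

lemma test_function:
  assumes z: "z \<in> UHP"
  defines "f \<equiv> \<lambda>w. of_real (ginv \<Phi>1 (1 / Im z)) * (2 * \<i> * of_real (Im z) / (w - cnj z))\<^sup>2"
  shows "f \<in> hardy_orlicz \<Phi>1" "lux_H \<Phi>1 f \<le> ennreal 64"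
proof -
  define y b where "y = Im z" and "b = ginv \<Phi>1 (1 / y)"
  have y: "y > 0" and b: "b > 0" "\<Phi>1 b = 1 / y" using z by (auto simp: y_def b_def UHP_def A.ginv_pos)
  have hol: "f holomorphic_on UHP"
    unfolding f_def using z by (intro holomorphic_intros) (auto simp: UHP_def complex_eq_iff)
  have int: "(\<integral>\<^sup>+ x. ennreal (\<Phi>1 (cmod (f (Complex x \<eta>)) / 64)) \<partial>lborel) \<le> 1" if \<eta>: "\<eta> > 0" for \<eta>
  proof -
    have "(\<integral>\<^sup>+ x. ennreal (\<Phi>1 (cmod (f (Complex x \<eta>)) / 64)) \<partial>lborel)
      \<le> (\<integral>\<^sup>+ x. ennreal (1 / 32) * (1 * ennreal (2 * y / ((x - Re z)\<^sup>2 + y\<^sup>2))) \<partial>lborel)"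
    proof (rule nn_integral_mono)
      fix x
      define k where "k = 4 * y\<^sup>2 / ((x - Re z)\<^sup>2 + y\<^sup>2)"
      have pos: "(x - Re z)\<^sup>2 + y\<^sup>2 > 0" using y by (simp add: add_nonneg_pos)
      have k: "0 \<le> k" "k \<le> 4" using y pos by (auto simp: k_def divide_le_eq)
      have n2: "(norm (Complex x \<eta> - cnj z))\<^sup>2 = (x - Re z)\<^sup>2 + (\<eta> + y)\<^sup>2"
        by (simp add: cmod_power2 y_def)
      have "cmod (f (Complex x \<eta>)) = b * (4 * y\<^sup>2 / (norm (Complex x \<eta> - cnj z))\<^sup>2)"
        using b y unfolding f_def y_def[symmetric] b_def[symmetric]
        by (simp add: norm_mult norm_power norm_divide power_divide power_mult_distrib)
      also have "\<dots> \<le> b * k"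
        unfolding n2 k_def using b y \<eta> pos
        by (intro mult_left_mono divide_left_mono add_left_mono power_mono mult_pos_pos) (auto simp: add_nonneg_pos)
      finally have "\<Phi>1 (cmod (f (Complex x \<eta>)) / 64) \<le> \<Phi>1 (k / 64 * b)"
        by (intro A.mono) (auto simp: mult.commute)
      also have "\<dots> \<le> k / 64 * \<Phi>1 b" using k b by (intro A.scale_le) auto
      also have "\<dots> = 1 / 32 * (2 * y / ((x - Re z)\<^sup>2 + y\<^sup>2))"
      proof -
        define S where "S = (x - Re z)\<^sup>2 + y\<^sup>2"
        have "S > 0" using pos by (simp add: S_def)
        thus ?thesis using y unfolding k_def b(2) S_def[symmetric] by (simp add: power2_eq_square)
      qed
      finally show "ennreal (\<Phi>1 (cmod (f (Complex x \<eta>)) / 64))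
        \<le> ennreal (1 / 32) * (1 * ennreal (2 * y / ((x - Re z)\<^sup>2 + y\<^sup>2)))"
        using y by (simp add: ennreal_mult[symmetric] ennreal_leI)
    qed
    also have "\<dots> = ennreal (1 / 32) * (\<integral>\<^sup>+ x. 1 * ennreal (2 * y / ((x - Re z)\<^sup>2 + y\<^sup>2)) \<partial>lborel)"
      by (rule nn_integral_cmult) measurable
    \<comment> \<open>The kernel estimate for the constant function 1, all of whose averages are
      1.\<close>
    also have "\<dots> \<le> ennreal (1 / 32) * ennreal (32 * 1)"
    proof (intro mult_left_mono Poisson_kernel_le_average)
      fix r :: real assume "r > 0"
      thus "(\<integral>\<^sup>+ t. 1 * indicator (cball (Re z) r) t \<partial>lborel) \<le> ennreal (2 * r * 1)"
        by (simp add: cball_eq_atLeastAtMost)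
    qed (use y in auto)
    also have "\<dots> = ennreal (1 / 32 * (32 * 1))" by (rule ennreal_mult[symmetric]) auto
    finally show ?thesis by simp
  qed
  show le: "lux_H \<Phi>1 f \<le> ennreal 64"
    unfolding lux_H_def using int by (intro SUP_least INF_lower) auto
  show "f \<in> hardy_orlicz \<Phi>1"
    using hol le by (auto simp: hardy_orlicz_def intro: le_less_trans)
qed

lemma multiplier_bound:
  assumes g: "g \<in> multipliers_HA \<Phi>1 \<Phi>2 \<alpha>"
  obtains C where "C \<ge> 0" "\<And>z. z \<in> UHP \<Longrightarrow> norm (g z) \<le> C * omega_weight \<Phi>1 \<Phi>2 \<alpha> (Im z)"
proof -
  obtain K where K: "K \<ge> 0" "\<And>h z. h holomorphic_on UHP \<Longrightarrow> Vint \<alpha> (\<lambda>w. \<Phi>2 (cmod (h w))) \<le> 1 \<Longrightarrow> z \<in> UHP \<Longrightarrow>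
       norm (h z) \<le> K * ginv \<Phi>2 (1 / Im z powr (2 + \<alpha>))"
    using B.bergman_pointwise[of \<alpha>] by blast
  obtain C where C: "C > 0" "\<And>f. f \<in> hardy_orlicz \<Phi>1 \<Longrightarrow>
      lux_A \<Phi>2 \<alpha> (\<lambda>z. f z * g z) \<le> ennreal C * lux_H \<Phi>1 f"
    and holg: "g holomorphic_on UHP"
    using g by (auto simp: multipliers_HA_def)
  \<comment> \<open>One more than the bound 64 C for the norm of f g, so that some admissible r' < r
    exists.\<close>
  define r where "r = 64 * C + 1"
  show ?thesis
  proof (rule that)
    show "r * K \<ge> 0" using C K by (simp add: r_def)
    fix z assume z: "z \<in> UHP"
    hence y: "Im z > 0" by (simp add: UHP_def)
    define b where "b = ginv \<Phi>1 (1 / Im z)"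
    define f where "f = (\<lambda>w. of_real b * (2 * \<i> * of_real (Im z) / (w - cnj z))\<^sup>2)"
    have b: "b > 0" using y by (simp add: b_def A.ginv_pos)
    have f: "f \<in> hardy_orlicz \<Phi>1" "lux_H \<Phi>1 f \<le> ennreal 64"
      unfolding f_def b_def using test_function[OF z] by auto
    have "lux_A \<Phi>2 \<alpha> (\<lambda>z. f z * g z) \<le> ennreal C * ennreal 64"
      using C(2)[OF f(1)] f(2) by (meson mult_left_mono order.trans zero_le)
    also have "\<dots> = ennreal (C * 64)" using C by (intro ennreal_mult[symmetric]) auto
    also have "\<dots> < ennreal r" using C unfolding r_def by (intro ennreal_lessI) auto
    finally obtain r' where r': "r' > 0" "Vint \<alpha> (\<lambda>z. \<Phi>2 (cmod (f z * g z) / r')) \<le> 1" "ennreal r' < ennreal r"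
      unfolding lux_A_def by (auto simp: INF_less_iff)
    hence "r' \<le> r" by (simp add: ennreal_less_iff)
    define h where "h = (\<lambda>w. f w * g w / of_real r')"
    have "f holomorphic_on UHP" using f(1) by (simp add: hardy_orlicz_def)
    hence "norm (h z) \<le> K * ginv \<Phi>2 (1 / Im z powr (2 + \<alpha>))"
      using holg r' z unfolding h_def
      by (intro K(2) holomorphic_intros) (simp_all add: norm_divide)
    moreover have "f z = of_real b"
    proof -
      have "z - cnj z = 2 * \<i> * of_real (Im z)" by (simp add: complex_eq_iff)
      thus ?thesis using y by (simp add: f_def)
    qed
    ultimately have "b * norm (g z) \<le> r' * (K * ginv \<Phi>2 (1 / Im z powr (2 + \<alpha>)))"
      using r' b by (simp add: h_def norm_mult norm_divide field_simps)
    also have "\<dots> \<le> r * (K * ginv \<Phi>2 (1 / Im z powr (2 + \<alpha>)))"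
      using \<open>r' \<le> r\<close> K by (intro mult_right_mono mult_nonneg_nonneg B.ginv_nonneg) auto
    finally show "norm (g z) \<le> r * K * omega_weight \<Phi>1 \<Phi>2 \<alpha> (Im z)"
      using b by (simp add: omega_weight_def b_def[symmetric] field_simps)
  qed
qed

end

text \<open>The bound depends on Im z only, so the decay is uniform in Re z; this makes the
  extension by 0 continuous at every real point, and it can be pasted across the real line.\<close>

lemma holomorphic_zero_of_boundary_decay:
  assumes hol: "g holomorphic_on UHP"
    and bd: "\<And>z. z \<in> UHP \<Longrightarrow> norm (g z) \<le> \<psi> (Im z)"
    and lim: "(\<psi> \<longlongrightarrow> 0) (at_right 0)"
    and z: "z \<in> UHP"
  shows "g z = 0"
proof -
  define F where "F = (\<lambda>z. if Im z > 0 then g z else 0)"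
  have cont: "isCont F w" for w
  proof -
    consider "Im w > 0" | "Im w < 0" | "Im w = 0" by linarith
    thus ?thesis
    proof cases
      case 1
      hence "\<forall>\<^sub>F v in nhds w. v \<in> UHP" by (intro eventually_nhds_in_open open_UHP) (simp add: UHP_def)
      hence "\<forall>\<^sub>F v in nhds w. F v = g v" by eventually_elim (simp add: F_def UHP_def)
      moreover have "isCont g w"
        using 1 holomorphic_on_imp_continuous_on[OF hol] open_UHP
        by (simp add: continuous_on_eq_continuous_at UHP_def)
      ultimately show ?thesis by (simp add: isCont_cong)
    next
      case 2
      hence "\<forall>\<^sub>F v in nhds w. v \<in> {v. Im v < 0}"
        by (intro eventually_nhds_in_open) (auto simp: open_halfspace_Im_lt)
      hence "\<forall>\<^sub>F v in nhds w. F v = 0" by eventually_elim (simp add: F_def)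
      thus ?thesis by (simp add: isCont_cong)
    next
      case 3
      show ?thesis unfolding continuous_at_eps_delta
      proof (intro allI impI)
        fix e :: real assume e: "e > 0"
        have "\<forall>\<^sub>F s in at_right 0. dist (\<psi> s) 0 < e" using lim e by (rule tendstoD)
        then obtain d where d: "d > 0" "\<And>s. 0 < s \<Longrightarrow> s < d \<Longrightarrow> \<bar>\<psi> s\<bar> < e"
          by (auto simp: eventually_at_right_field)
        show "\<exists>d>0. \<forall>v. dist v w < d \<longrightarrow> dist (F v) (F w) < e"
        proof (intro exI[of _ d] conjI allI impI d(1))
          fix v assume v: "dist v w < d"
          have "\<bar>Im v\<bar> < d" using v 3 abs_Im_le_cmod[of "v - w"] by (simp add: dist_norm)
          hence "norm (F v) < e"
            using d(2)[of "Im v"] bd[of v] e by (auto simp: F_def UHP_def)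
          thus "dist (F v) (F w) < e" using 3 by (simp add: F_def)
        qed
      qed
    qed
  qed
  have "F holomorphic_on UNIV"
  proof (rule holomorphic_on_paste_across_line[where d = \<i> and k = 0])
    have "F holomorphic_on UHP"
      by (rule holomorphic_transform[OF hol]) (simp add: F_def UHP_def)
    thus "F holomorphic_on UNIV \<inter> {z. 0 < \<i> \<bullet> z}" by (simp add: UHP_def)
    have "F holomorphic_on {z. Im z < 0}"
      by (rule holomorphic_transform[of "\<lambda>_. 0"]) (auto simp: F_def)
    thus "F holomorphic_on UNIV \<inter> {z. \<i> \<bullet> z < 0}" by simp
    show "continuous_on UNIV F" using cont by (simp add: continuous_on_eq_continuous_at)
  qed auto
  moreover have "{z. Im z < 0} \<noteq> {}" by (auto intro: exI[of _ "- \<i>"])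
  ultimately have "F z = (\<lambda>_. 0) z"
    by (intro analytic_continuation_open[of "{z. Im z < 0}" UNIV F "\<lambda>_. 0" z])
      (auto simp: F_def open_halfspace_Im_lt)
  thus ?thesis using z by (simp add: F_def UHP_def)
qed

lemma classU_tilde_subset: "classU_tilde \<subseteq> classU"
  by (auto simp: classU_tilde_def classU_def)

section \<open>Comparison of the weight with the critical density\<close>

context U_pair
begin

text \<open>With s = 1/t the bounds on the weight say that \<Phi>2^{-1}(s^(2+\<alpha>)) and
  \<Phi>1^{-1}(s) are comparable, and doubling of \<Phi>2 makes \<Phi>2(\<Phi>1^{-1}(s)) comparable
  with s^(2+\<alpha>). Both halves together give the lower type; the upper half alone gives the
  bound on y^\<alpha>.\<close>

lemma lower_type_of_omega_bounded:
  assumes \<alpha>: "\<alpha> > -1" and c: "0 < c" and b: "\<And>t. t > 0 \<Longrightarrow> c \<le> omega_weight \<Phi>1 \<Phi>2 \<alpha> t \<and> omega_weight \<Phi>1 \<Phi>2 \<alpha> t \<le> C"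
  obtains D E where "D \<ge> 1" "E \<ge> 0" "lower_type (1 + \<alpha>) E (\<Phi>2 \<circ> ginv \<Phi>1)"
    "\<And>y. y > 0 \<Longrightarrow> y powr \<alpha> \<le> D * kap y"
proof -
  define a b where "a = (\<lambda>s. ginv \<Phi>2 (s powr (2 + \<alpha>)))" and "b = (\<lambda>s. ginv \<Phi>1 s)"
  have ab: "c * b s \<le> a s" "a s \<le> C * b s" "a s > 0" "b s > 0" if "s > 0" for s
  proof -
    have "omega_weight \<Phi>1 \<Phi>2 \<alpha> (1 / s) = a s / b s"
      using that by (simp add: omega_weight_def a_def b_def powr_divide)
    moreover show p: "a s > 0" "b s > 0" using that by (simp_all add: a_def b_def A.ginv_pos B.ginv_pos)
    ultimately have "c \<le> a s / b s" "a s / b s \<le> C"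
      using assms(3)[of "1 / s"] that by simp_all
    thus "c * b s \<le> a s" "a s \<le> C * b s" using p by (simp_all add: field_simps)
  qed
  obtain D where D: "D \<ge> 1" "\<And>t. 0 \<le> t \<Longrightarrow> \<Phi>2 (max 1 (1 / c) * t) \<le> D * \<Phi>2 t"
    using B.doubling[of "max 1 (1 / c)"] by auto
  obtain E where E: "E \<ge> 1" "\<And>t. 0 \<le> t \<Longrightarrow> \<Phi>2 (max 1 C * t) \<le> E * \<Phi>2 t"
    using B.doubling[of "max 1 C"] by auto
  have \<Phi>a: "\<Phi>2 (a s) = s powr (2 + \<alpha>)" for s by (simp add: a_def)
  have upper: "\<Phi>2 (b s) \<le> D * s powr (2 + \<alpha>)" if "s > 0" for s
  proof -
    have "b s \<le> 1 / c * a s" using ab[OF that] c by (simp add: field_simps)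
    also have "\<dots> \<le> max 1 (1 / c) * a s" using ab[OF that] by (intro mult_right_mono) auto
    finally have "\<Phi>2 (b s) \<le> \<Phi>2 (max 1 (1 / c) * a s)" using ab[OF that] by (intro B.mono) auto
    also have "\<dots> \<le> D * \<Phi>2 (a s)" using ab[OF that] by (intro D) auto
    finally show ?thesis by (simp add: \<Phi>a)
  qed
  have lower: "s powr (2 + \<alpha>) \<le> E * \<Phi>2 (b s)" if "s > 0" for s
  proof -
    have "a s \<le> max 1 C * b s"
      using ab[OF that] mult_right_mono[of C "max 1 C" "b s"] by linarith
    hence "\<Phi>2 (a s) \<le> \<Phi>2 (max 1 C * b s)" using ab[OF that] by (intro B.mono) auto
    also have "\<dots> \<le> E * \<Phi>2 (b s)" using ab[OF that] by (intro E) auto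
    finally show ?thesis by (simp add: \<Phi>a)
  qed
  show ?thesis
  proof (rule that)
    show "D \<ge> 1" "D * E \<ge> 0" using D E by auto
    show "lower_type (1 + \<alpha>) (D * E) (\<Phi>2 \<circ> ginv \<Phi>1)"
      unfolding lower_type_def
    proof (intro allI impI)
      fix s t :: real assume st: "0 < s" "s \<le> t"
      have "\<Phi>2 (b s) / s \<le> D * s powr (2 + \<alpha>) / s" using upper[of s] st by (intro divide_right_mono) auto
      also have "\<dots> = D * (s / t) powr (1 + \<alpha>) * (t powr (2 + \<alpha>) / t)"
        using st by (simp add: powr_divide powr_add powr_numeral power2_eq_square)
      also have "\<dots> \<le> D * (s / t) powr (1 + \<alpha>) * (E * \<Phi>2 (b t) / t)"
        using lower[of t] st D by (intro mult_left_mono divide_right_mono) auto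
      finally show "(\<Phi>2 \<circ> ginv \<Phi>1) s / s \<le> D * E * (s / t) powr (1 + \<alpha>) * ((\<Phi>2 \<circ> ginv \<Phi>1) t / t)"
        by (simp add: b_def mult_ac)
    qed
    fix y :: real assume y: "y > 0"
    have p: "\<Phi>2 (b (1 / y)) > 0" using ab[of "1 / y"] y by (intro B.pos) auto
    have "\<Phi>2 (b (1 / y)) \<le> D * (1 / y) powr (2 + \<alpha>)" using upper[of "1 / y"] y by simp
    hence "y\<^sup>2 * y powr \<alpha> * \<Phi>2 (b (1 / y)) \<le> D"
      using y by (simp add: powr_divide powr_add powr_numeral field_simps)
    thus "y powr \<alpha> \<le> D * kap y"
      using p y by (simp add: kap_def b_def[symmetric] field_simps)
  qed
qed

text \<open>The weight is a/b with \<Phi>2(a) = y^(-2-\<alpha>) and \<Phi>1(b) = 1/y, so it suffices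
  that \<Phi>2(a/b) \<le> D \<Phi>2(a)/\<Phi>2(b). The conditions of \<open>classU_tilde\<close>
  give this for a \<le> b \<le> 1 and, combined with the upper type, for a, b \<ge> 1. Rescaling a
  by a fixed factor, absorbed by doubling, brings every y into one of these ranges.\<close>

lemma Phi2_omega_le:
  assumes \<Phi>2: "\<Phi>2 \<in> classU_tilde"
    and anti: "monotone_on {0<..} (\<le>) (\<ge>) (omega_weight \<Phi>1 \<Phi>2 \<alpha>)" and \<alpha>: "\<alpha> > -1"
  obtains D where "D \<ge> 0" "\<And>y. y > 0 \<Longrightarrow> y powr \<alpha> * \<Phi>2 (omega_weight \<Phi>1 \<Phi>2 \<alpha> y) \<le> D * kap y"
proof -
  obtain q C2 C3 where q: "\<Phi>2 \<in> classU_q q"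
    and C2: "C2 > 0" "\<forall>a\<ge>1. \<forall>b\<ge>1. \<Phi>2 (a / b) \<le> C2 * \<Phi>2 a / b powr q"
    and C3: "C3 > 0" "\<forall>a b. 0 < a \<and> a \<le> b \<and> b \<le> 1 \<longrightarrow> \<Phi>2 (a / b) \<le> C3 * \<Phi>2 a / \<Phi>2 b"
    using \<Phi>2 unfolding classU_tilde_def by (elim CollectE exE conjE) (rule that)
  obtain C where "\<forall>s>0. \<forall>t\<ge>1. \<Phi>2 (s * t) \<le> C * t powr q * \<Phi>2 s"
    using q unfolding classU_q_def by blast
  note C = this[rule_format]
  note C2 = C2(1) C2(2)[rule_format]
  note C3 = C3(1) C3(2)[rule_format, OF conjI, OF _ conjI]
  define a b where "a = (\<lambda>y. ginv \<Phi>2 (1 / y powr (2 + \<alpha>)))" and "b = (\<lambda>y. ginv \<Phi>1 (1 / y))"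
  have \<omega>: "omega_weight \<Phi>1 \<Phi>2 \<alpha> y = a y / b y" for y by (simp add: omega_weight_def a_def b_def)
  have ab: "a y > 0" "b y > 0" "\<Phi>2 (a y) = 1 / y powr (2 + \<alpha>)" "\<Phi>1 (b y) = 1 / y" if "y > 0" for y
    using that by (simp_all add: a_def b_def A.ginv_pos B.ginv_pos)
  \<comment> \<open>Here b(y0) = 1, so y0 separates the range b \<le> 1 from the range b >
    1.\<close>
  define y0 where "y0 = 1 / \<Phi>1 1"
  have y0: "y0 > 0" using A.pos[of 1] by (simp add: y0_def)
  \<comment> \<open>W and m are the rescaling factors: for y \<ge> y0 the nonincreasing weight gives
    a/W \<le> b, and for y < y0 the monotonicity of a gives a/m \<ge> 1.\<close>
  define W where "W = max 1 (a y0 / b y0)"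
  define m where "m = min 1 (a y0)"
  have m: "0 < m" "m \<le> 1" using ab[OF y0] by (auto simp: m_def)
  have W: "W \<ge> 1" by (simp add: W_def)
  obtain DW where DW: "DW \<ge> 1" "\<And>t. 0 \<le> t \<Longrightarrow> \<Phi>2 (W * t) \<le> DW * \<Phi>2 t"
    using B.doubling[OF W] by auto
  obtain Dm where Dm: "Dm \<ge> 1" "\<And>t. 0 \<le> t \<Longrightarrow> \<Phi>2 (1 / m * t) \<le> Dm * \<Phi>2 t"
    using B.doubling[of "1 / m"] m by auto
  define D where "D = max (DW * C3) (C2 * Dm * \<bar>C\<bar> * \<Phi>2 1)"
  have D: "D \<ge> 0" using DW C3 by (simp add: D_def le_max_iff_disj)
  have key: "\<Phi>2 (a y / b y) \<le> D * (\<Phi>2 (a y) / \<Phi>2 (b y))" if y: "y > 0" for y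
  proof -
    note [simp] = ab(1,2)[OF y]
    have p: "\<Phi>2 (a y) > 0" "\<Phi>2 (b y) > 0" by (simp_all add: B.pos)
    show ?thesis
    proof (cases "b y \<le> 1")
      case True
      hence "\<Phi>1 (b y) \<le> \<Phi>1 1" by (intro A.mono) (auto intro: less_imp_le)
      hence "y0 \<le> y" using y A.pos[of 1] by (simp add: ab(4)[OF y] y0_def field_simps)
      hence "a y / b y \<le> a y0 / b y0"
        using anti y0 y by (auto simp: monotone_on_def \<omega>)
      hence "a y / b y \<le> W" by (simp add: W_def)
      hence "a y \<le> W * b y" by (simp add: pos_divide_le_eq)
      hence aW: "a y / W \<le> b y" using W by (simp add: pos_divide_le_eq mult.commute)
      have "a y / b y = W * (a y / W / b y)" using W by simp
      also have "\<Phi>2 \<dots> \<le> DW * \<Phi>2 (a y / W / b y)" using W by (intro DW) (auto intro: less_imp_le)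
      also have "\<dots> \<le> DW * (C3 * \<Phi>2 (a y / W) / \<Phi>2 (b y))"
        using DW W aW True by (intro mult_left_mono C3) auto
      also have "\<dots> \<le> DW * (C3 * \<Phi>2 (a y) / \<Phi>2 (b y))"
      proof -
        have "a y / W \<le> a y" using W mult_left_mono[of 1 W "a y"] by (simp add: field_simps)
        hence "\<Phi>2 (a y / W) \<le> \<Phi>2 (a y)" using W by (intro B.mono) (auto intro: less_imp_le)
        thus ?thesis using DW C3 p by (intro mult_left_mono divide_right_mono) auto
      qed
      also have "\<dots> = DW * C3 * (\<Phi>2 (a y) / \<Phi>2 (b y))" by simp
      also have "\<dots> \<le> D * (\<Phi>2 (a y) / \<Phi>2 (b y))"
        using p by (intro mult_right_mono) (auto simp: D_def)
      finally show ?thesis .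
    next
      case False
      hence b1: "b y > 1" by simp
      hence "\<Phi>1 1 < \<Phi>1 (b y)" by (intro A.strict_mono) auto
      hence yy0: "y < y0" using y A.pos[of 1] by (simp add: ab(4)[OF y] y0_def field_simps)
      have "y powr (2 + \<alpha>) \<le> y0 powr (2 + \<alpha>)" using yy0 y \<alpha> by (intro powr_mono2) auto
      hence "\<Phi>2 (a y0) \<le> \<Phi>2 (a y)" 
        unfolding ab(3)[OF y] ab(3)[OF y0] using y y0 by (intro divide_left_mono) auto
      hence "a y0 \<le> a y" using ab(1)[OF y0] by (subst (asm) B.le_iff) (auto intro: less_imp_le)
      hence am: "a y / m \<ge> 1" using m by (simp add: m_def field_simps)
      have bq: "b y powr q > 0" using b1 by simp
      \<comment> \<open>The upper type has the same exponent q as the second condition of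
        \<open>classU_tilde\<close>, so the power of b in that condition can be exchanged for
        \<Phi>2(b).\<close>
      have "\<Phi>2 (b y) \<le> C * b y powr q * \<Phi>2 1" using C[of 1 "b y"] b1 by simp
      also have "\<dots> \<le> \<bar>C\<bar> * b y powr q * \<Phi>2 1"
        by (intro mult_right_mono) (auto simp: B.nonneg)
      finally have up: "\<Phi>2 (b y) \<le> \<bar>C\<bar> * b y powr q * \<Phi>2 1" .
      have "a y \<le> a y / m" using m by (simp add: field_simps)
      hence "\<Phi>2 (a y / b y) \<le> \<Phi>2 (a y / m / b y)"
        by (intro B.mono divide_right_mono) (auto intro: less_imp_le)
      also have "\<dots> \<le> C2 * \<Phi>2 (a y / m) / b y powr q" using am b1 by (intro C2) auto
      also have "\<dots> \<le> C2 * (Dm * \<Phi>2 (a y)) / b y powr q"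
        using Dm(2)[OF less_imp_le[OF ab(1)[OF y]]] C2 by (intro divide_right_mono mult_left_mono) auto
      also have "\<dots> = C2 * Dm * \<Phi>2 (a y) * (1 / b y powr q)" by simp
      also have "1 / b y powr q \<le> \<bar>C\<bar> * \<Phi>2 1 / \<Phi>2 (b y)"
        using up p bq by (simp add: field_simps)
      hence "C2 * Dm * \<Phi>2 (a y) * (1 / b y powr q) \<le> C2 * Dm * \<Phi>2 (a y) * (\<bar>C\<bar> * \<Phi>2 1 / \<Phi>2 (b y))"
        using C2 Dm p by (intro mult_left_mono) auto
      also have "\<dots> = (C2 * Dm * \<bar>C\<bar> * \<Phi>2 1) * (\<Phi>2 (a y) / \<Phi>2 (b y))" by simp
      also have "\<dots> \<le> D * (\<Phi>2 (a y) / \<Phi>2 (b y))"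
        using p by (intro mult_right_mono) (auto simp: D_def)
      finally show ?thesis .
    qed
  qed
  show ?thesis
  proof (rule that[OF D])
    fix y :: real assume y: "y > 0"
    have "y powr \<alpha> * \<Phi>2 (a y / b y) \<le> y powr \<alpha> * (D * (\<Phi>2 (a y) / \<Phi>2 (b y)))"
      by (intro mult_left_mono key y) auto
    also have "\<dots> = D * kap y"
    proof -
      have "kap y = 1 / (y\<^sup>2 * \<Phi>2 (b y))" by (simp add: kap_def b_def)
      thus ?thesis using y by (simp add: ab powr_add powr_numeral)
    qed
    finally show "y powr \<alpha> * \<Phi>2 (omega_weight \<Phi>1 \<Phi>2 \<alpha> y) \<le> D * kap y" by (simp add: \<omega>)
  qed
qed

lemma lower_type_nabla2:
  assumes "nabla2 \<Phi>1" obtains \<delta> where "\<delta> > 0" "lower_type \<delta> 2 \<Phi>1"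
proof -
  obtain K where K: "K > 1" "\<And>x. 0 < x \<Longrightarrow> 2 * K * \<Phi>1 x \<le> \<Phi>1 (K * x)"
    using nabla2_lower_type[OF assms] by blast
  show ?thesis
    using lower_typeI[OF A.ratio_mono A.pos K] that by blast
qed

text \<open>For s = \<Phi>1(t) the ratio \<Phi>2(\<Phi>1^{-1}(s))/s equals \<Phi>2(t)/\<Phi>1(t), so
  the ratio condition of \<open>lower_typeI\<close> is the assumed monotonicity of the
  quotient.\<close>

lemma lower_type_comp_nabla2:
  assumes mono: "mono_on {0<..} (\<lambda>t. \<Phi>2 t / \<Phi>1 t)" and n: "nabla2 (\<Phi>2 \<circ> ginv \<Phi>1)"
  obtains \<delta> where "\<delta> > 0" "lower_type \<delta> 2 (\<Phi>2 \<circ> ginv \<Phi>1)"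
proof -
  obtain K where K: "K > 1" "\<And>x. 0 < x \<Longrightarrow> 2 * K * (\<Phi>2 \<circ> ginv \<Phi>1) x \<le> (\<Phi>2 \<circ> ginv \<Phi>1) (K * x)"
    using nabla2_lower_type[OF n] by blast
  have "(\<Phi>2 \<circ> ginv \<Phi>1) s / s \<le> (\<Phi>2 \<circ> ginv \<Phi>1) t / t" if st: "0 < s" "s \<le> t" for s t
  proof -
    have "ginv \<Phi>1 s \<le> ginv \<Phi>1 t" using st by (subst A.ginv_le_iff) (auto simp: A.ginv_nonneg)
    hence "\<Phi>2 (ginv \<Phi>1 s) / \<Phi>1 (ginv \<Phi>1 s) \<le> \<Phi>2 (ginv \<Phi>1 t) / \<Phi>1 (ginv \<Phi>1 t)"
      using mono_onD[OF mono, of "ginv \<Phi>1 s" "ginv \<Phi>1 t"] A.ginv_pos st by auto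
    thus ?thesis using st by simp
  qed
  moreover have "0 < (\<Phi>2 \<circ> ginv \<Phi>1) s" if "0 < s" for s using that by (simp add: B.pos A.ginv_pos)
  ultimately show ?thesis using lower_typeI[of "\<Phi>2 \<circ> ginv \<Phi>1" K] K that by blast
qed

section \<open>The three multiplier spaces\<close>

lemma multipliers_bounded_weight:
  assumes \<alpha>: "\<alpha> > -1" and n1: "nabla2 \<Phi>1"
    and c: "0 < c" and \<omega>: "\<And>t. t > 0 \<Longrightarrow> c \<le> omega_weight \<Phi>1 \<Phi>2 \<alpha> t \<and> omega_weight \<Phi>1 \<Phi>2 \<alpha> t \<le> C"
  shows "multipliers_HA \<Phi>1 \<Phi>2 \<alpha> = H_infty"
proof (intro equalityI subsetI)
  fix g assume g: "g \<in> multipliers_HA \<Phi>1 \<Phi>2 \<alpha>"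
  then obtain K where K: "K \<ge> 0" "\<And>z. z \<in> UHP \<Longrightarrow> norm (g z) \<le> K * omega_weight \<Phi>1 \<Phi>2 \<alpha> (Im z)"
    by (rule multiplier_bound) blast
  have "norm (g z) \<le> K * C" if "z \<in> UHP" for z
    using K(2)[OF that] \<omega>[of "Im z"] mult_left_mono[OF _ K(1), of "omega_weight \<Phi>1 \<Phi>2 \<alpha> (Im z)" C] that
    by (auto simp: UHP_def)
  thus "g \<in> H_infty" using g
    by (auto simp: H_infty_def multipliers_HA_def intro!: boundedI[of _ "K * C"])
next
  fix g assume g: "g \<in> H_infty"
  obtain G where G: "\<And>z. z \<in> UHP \<Longrightarrow> norm (g z) \<le> G"
    using g by (auto simp: H_infty_def bounded_iff)
  obtain B where B: "B \<ge> 1" "\<And>t. 0 \<le> t \<Longrightarrow> \<Phi>2 (max 1 G * t) \<le> B * \<Phi>2 t"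
    using B.doubling[of "max 1 G"] by auto
  obtain \<delta> where \<delta>: "\<delta> > 0" "lower_type \<delta> 2 \<Phi>1" using lower_type_nabla2[OF n1] by blast
  obtain D E where D: "D \<ge> 1" "E \<ge> 0" "lower_type (1 + \<alpha>) E (\<Phi>2 \<circ> ginv \<Phi>1)"
    "\<And>y. y > 0 \<Longrightarrow> y powr \<alpha> \<le> D * kap y"
    using lower_type_of_omega_bounded[OF \<alpha> c \<omega>] by blast
  show "g \<in> multipliers_HA \<Phi>1 \<Phi>2 \<alpha>"
  \<comment> \<open>The power law for \<Phi>2 composed with \<open>ginv \<Phi>1\<close> supplies the
    second lower type, with exponent 1 + \<alpha> > 0; the bound of |g| is absorbed by
    doubling.\<close>
  proof (rule multiplierI[OF \<delta>(2,1) _ D(3) _ D(2), where D = "D * B"])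
    show "g holomorphic_on UHP" using g by (simp add: H_infty_def)
    show "0 \<le> D * B" using D B by simp
    fix z t assume z: "z \<in> UHP" and t: "(0::real) \<le> t"
    have "\<Phi>2 (norm (g z) * t) \<le> \<Phi>2 (max 1 G * t)"
      using G[OF z] t by (intro B.mono mult_right_mono) auto
    also have "\<dots> \<le> B * \<Phi>2 t" using t by (rule B)
    finally have "Im z powr \<alpha> * \<Phi>2 (norm (g z) * t) \<le> (D * kap (Im z)) * (B * \<Phi>2 t)"
      using D(4)[of "Im z"] z t by (intro mult_mono') (auto simp: UHP_def B.nonneg)
    thus "Im z powr \<alpha> * \<Phi>2 (norm (g z) * t) \<le> D * B * (kap (Im z) * \<Phi>2 t)" by (simp add: mult_ac)
  qed (use \<alpha> in auto)
qed

text \<open>Functions are total on the complex numbers, and their values off \<open>UHP\<close> are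
  irrelevant; the zero space is therefore described by vanishing on \<open>UHP\<close>.\<close>

lemma multipliers_vanishing_weight:
  assumes lim: "(omega_weight \<Phi>1 \<Phi>2 \<alpha> \<longlongrightarrow> 0) (at_right 0)"
  shows "multipliers_HA \<Phi>1 \<Phi>2 \<alpha> = {g. g holomorphic_on UHP \<and> (\<forall>z\<in>UHP. g z = 0)}"
proof (intro equalityI subsetI)
  fix g assume g: "g \<in> multipliers_HA \<Phi>1 \<Phi>2 \<alpha>"
  then obtain K where K: "K \<ge> 0" "\<And>z. z \<in> UHP \<Longrightarrow> norm (g z) \<le> K * omega_weight \<Phi>1 \<Phi>2 \<alpha> (Im z)"
    by (rule multiplier_bound) blast
  have hol: "g holomorphic_on UHP" using g by (simp add: multipliers_HA_def)
  have "((\<lambda>t. K * omega_weight \<Phi>1 \<Phi>2 \<alpha> t) \<longlongrightarrow> 0) (at_right 0)"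
    using tendsto_mult_left[OF lim, of K] by simp
  from holomorphic_zero_of_boundary_decay[OF hol K(2) this] hol
  show "g \<in> {g. g holomorphic_on UHP \<and> (\<forall>z\<in>UHP. g z = 0)}" by blast
next
  fix g assume "g \<in> {g. g holomorphic_on UHP \<and> (\<forall>z\<in>UHP. g z = 0)}"
  hence g: "g holomorphic_on UHP" "\<And>z. z \<in> UHP \<Longrightarrow> g z = 0" by auto
  have "lux_A \<Phi>2 \<alpha> (\<lambda>z. f z * g z) \<le> 0" for f
  proof (rule ennreal_le_epsilon)
    fix e :: real assume e: "e > 0"
    have zero: "indicator UHP z * ennreal (Im z powr \<alpha> * \<Phi>2 (cmod (f z * g z) / e)) = 0" for z
      using g(2)[of z] by (cases "z \<in> UHP") auto
    have "Vint \<alpha> (\<lambda>z. \<Phi>2 (cmod (f z * g z) / e)) \<le> 1" unfolding Vint_def by (simp only: zero) simp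
    hence "lux_A \<Phi>2 \<alpha> (\<lambda>z. f z * g z) \<le> ennreal e"
      unfolding lux_A_def using e by (intro INF_lower) auto
    thus "lux_A \<Phi>2 \<alpha> (\<lambda>z. f z * g z) \<le> 0 + ennreal e" by simp
  qed
  thus "g \<in> multipliers_HA \<Phi>1 \<Phi>2 \<alpha>" using g(1)
    by (auto simp: multipliers_HA_def intro!: exI[of _ "1::real"])
qed

text \<open>Submultiplicativity of \<Phi>2 splits \<Phi>2(\<omega> t) into \<Phi>2(\<omega>)
  \<Phi>2(t) up to a constant; the first factor times y^\<alpha> is controlled by
  \<open>kap\<close>.\<close>

lemma multipliers_decreasing_weight:
  assumes \<Phi>2: "\<Phi>2 \<in> classU_tilde" and mono: "mono_on {0<..} (\<lambda>t. \<Phi>2 t / \<Phi>1 t)"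
    and \<alpha>: "\<alpha> > -1" and n1: "nabla2 \<Phi>1" and n3: "nabla2 (\<Phi>2 \<circ> ginv \<Phi>1)"
    and anti: "monotone_on {0<..} (\<le>) (\<ge>) (omega_weight \<Phi>1 \<Phi>2 \<alpha>)"
  shows "multipliers_HA \<Phi>1 \<Phi>2 \<alpha> = H_infty_weighted (omega_weight \<Phi>1 \<Phi>2 \<alpha>)"
proof (intro equalityI subsetI)
  fix g assume g: "g \<in> multipliers_HA \<Phi>1 \<Phi>2 \<alpha>"
  then obtain K where K: "K \<ge> 0" "\<And>z. z \<in> UHP \<Longrightarrow> norm (g z) \<le> K * omega_weight \<Phi>1 \<Phi>2 \<alpha> (Im z)"
    by (rule multiplier_bound) blast
  have "norm (g z) / omega_weight \<Phi>1 \<Phi>2 \<alpha> (Im z) \<le> K" if "z \<in> UHP" for z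
    using K(2)[OF that] omega_pos[of "Im z" \<alpha>] that by (simp add: UHP_def field_simps)
  thus "g \<in> H_infty_weighted (omega_weight \<Phi>1 \<Phi>2 \<alpha>)" using g
    by (auto simp: H_infty_weighted_def multipliers_HA_def)
next
  let ?\<omega> = "omega_weight \<Phi>1 \<Phi>2 \<alpha>"
  fix g assume g: "g \<in> H_infty_weighted ?\<omega>"
  then obtain G where G: "\<And>z. z \<in> UHP \<Longrightarrow> norm (g z) / ?\<omega> (Im z) \<le> G"
    by (auto simp: H_infty_weighted_def)
  obtain B where B: "B \<ge> 1" "\<And>t. 0 \<le> t \<Longrightarrow> \<Phi>2 (max 1 G * t) \<le> B * \<Phi>2 t"
    using B.doubling[of "max 1 G"] by auto
  obtain C where C: "C > 0" "\<And>s t. s > 0 \<Longrightarrow> t > 0 \<Longrightarrow> \<Phi>2 (s * t) \<le> C * \<Phi>2 s * \<Phi>2 t"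
    using \<Phi>2 unfolding classU_tilde_def mem_Collect_eq by metis
  obtain \<delta> where \<delta>: "\<delta> > 0" "lower_type \<delta> 2 \<Phi>1" using lower_type_nabla2[OF n1] by blast
  obtain \<delta>3 where \<delta>3: "\<delta>3 > 0" "lower_type \<delta>3 2 (\<Phi>2 \<circ> ginv \<Phi>1)"
    using lower_type_comp_nabla2[OF mono n3] by blast
  obtain D where D: "D \<ge> 0" "\<And>y. y > 0 \<Longrightarrow> y powr \<alpha> * \<Phi>2 (?\<omega> y) \<le> D * kap y"
    using Phi2_omega_le[OF \<Phi>2 anti \<alpha>] by blast
  show "g \<in> multipliers_HA \<Phi>1 \<Phi>2 \<alpha>"
  proof (rule multiplierI[OF \<delta>(2,1) _ \<delta>3(2,1), where D = "B * C * D"])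
    show "g holomorphic_on UHP" using g by (simp add: H_infty_weighted_def)
    show "0 \<le> B * C * D" using B C D by simp
    fix z t assume z: "z \<in> UHP" and t: "(0::real) \<le> t"
    have y: "Im z > 0" and w: "?\<omega> (Im z) > 0" using z omega_pos by (auto simp: UHP_def)
    show "Im z powr \<alpha> * \<Phi>2 (norm (g z) * t) \<le> B * C * D * (kap (Im z) * \<Phi>2 t)"
    \<comment> \<open>Submultiplicativity is available for positive arguments only.\<close>
    proof (cases "t = 0")
      case False
      hence t: "t > 0" using t by simp
      have "norm (g z) \<le> G * ?\<omega> (Im z)" using G[OF z] w by (simp add: field_simps)
      also have "\<dots> \<le> max 1 G * ?\<omega> (Im z)" using w by (intro mult_right_mono) auto
      finally have "norm (g z) * t \<le> max 1 G * (?\<omega> (Im z) * t)"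
        using t by (simp add: mult.assoc[symmetric] mult_right_mono)
      hence "\<Phi>2 (norm (g z) * t) \<le> \<Phi>2 (max 1 G * (?\<omega> (Im z) * t))" using t by (intro B.mono) auto
      also have "\<dots> \<le> B * \<Phi>2 (?\<omega> (Im z) * t)" using t w by (intro B) auto
      also have "\<dots> \<le> B * (C * \<Phi>2 (?\<omega> (Im z)) * \<Phi>2 t)" using t w B by (intro mult_left_mono C) auto
      finally have "Im z powr \<alpha> * \<Phi>2 (norm (g z) * t) \<le> Im z powr \<alpha> * (B * (C * \<Phi>2 (?\<omega> (Im z)) * \<Phi>2 t))"
        by (intro mult_left_mono) auto
      also have "\<dots> = B * C * \<Phi>2 t * (Im z powr \<alpha> * \<Phi>2 (?\<omega> (Im z)))" by (simp add: mult_ac)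
      also have "\<dots> \<le> B * C * \<Phi>2 t * (D * kap (Im z))"
        using B C t by (intro mult_left_mono D y) (auto simp: B.nonneg)
      finally show ?thesis by (simp add: mult_ac)
    qed auto
  qed auto
qed

end

theorem theorem2p5:
  fixes \<Phi>1 \<Phi>2 :: "real \<Rightarrow> real" and \<alpha> :: real and \<omega> :: "real \<Rightarrow> real"
  assumes "\<Phi>1 \<in> classU" and "\<Phi>2 \<in> classU_tilde"
    and "mono_on {0<..} (\<lambda>t. \<Phi>2 t / \<Phi>1 t)"
    and "\<alpha> > -1"
    and "\<omega> = omega_weight \<Phi>1 \<Phi>2 \<alpha>"
  shows "(nabla2 \<Phi>1 \<and> (\<exists>c C. 0 < c \<and> c \<le> C \<and> (\<forall>t>0. c \<le> \<omega> t \<and> \<omega> t \<le> C))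
           \<longrightarrow> multipliers_HA \<Phi>1 \<Phi>2 \<alpha> = H_infty)
       \<and> (mono_on {0<..} \<omega> \<and> (\<omega> \<longlongrightarrow> 0) (at_right 0)
           \<longrightarrow> multipliers_HA \<Phi>1 \<Phi>2 \<alpha> = {g. g holomorphic_on UHP \<and> (\<forall>z\<in>UHP. g z = 0)})
       \<and> (nabla2 \<Phi>1 \<and> nabla2 (\<Phi>2 \<circ> ginv \<Phi>1) \<and> monotone_on {0<..} (\<le>) (\<ge>) \<omega>
           \<longrightarrow> multipliers_HA \<Phi>1 \<Phi>2 \<alpha> = H_infty_weighted \<omega>)"
proof -
  interpret U_pair \<Phi>1 \<Phi>2
    using assms(1,2) classU_tilde_subset by unfold_locales auto
  show ?thesis
    unfolding assms(5)
    using multipliers_bounded_weight[OF assms(4)] multipliers_vanishing_weight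
      multipliers_decreasing_weight[OF assms(2,3,4)]
    by blast
qed

end
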